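(* Assume the standing setting and assumptions given in the context, and let $N\in\mathbb{N}$ with $N\ge 1$ be arbitrary. The set $\mathcal{S}$ is robustly exponentially stable for the uncertain dynamics $x^+\in Ax+B\kappa_T(x)\oplus\mathcal{W}$ with the domain of attraction equal to the $T$-controllable set $\mathcal{C}_T$.
   Context: Notation. $\mathbb{N}$ is the set of non-negative integers; $\mathbb{N}_b=\{0,1,\dots,b\}$ for $b\in\mathbb{N}$, and $\mathbb{N}_{-1}=\emptyset$. Empty sums are $0$. $\rho(M)$ is the spectral radius; a square matrix $M$ is strictly stable iff $\rho(M)<1$. $\bigoplus$ and $\oplus$ denote Minkowski sums (a point is identified with a singleton). For a set $\mathcal{X}$, matrix $M$ and $k\in\mathbb{N}$, $M^k\mathcal{X}=\{M^kx: x\in\mathcal{X}\}$ and $M^{-k}\mathcal{X}=\{y: M^ky\in\mathcal{X}\}$ (preimage; $M$ need not be invertible). A proper $D$-set is a closed convex set containing the origin in its interior; a proper $C$-set is a bounded proper $D$-set. A polyhedral set is an intersection of finitely many closed half-spaces; a polytopic set is a bounded polyhedral set. The support function is $h(\mathcal{X},y)=\sup\{y^\top x: x\in\mathcal{X}\}$. $\operatorname{distance}(\mathcal{S},x)=\inf\{\|x-s\|: s\in\mathcal{S}\}$. Setting and assumptions. - $A\in\mathbb{R}^{n\times n}$, $B\in\mathbb{R}^{n\times m}$, and $(A,B)$ is strictly stabilizable (some $K$ makes $A+BK$ strictly stable). - $\mathcal{Y}=\{(x,u)\in\mathbb{R}^n\times\mathbb{R}^m: c_i^\top x+d_i^\top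 u\le 1\ \forall i\in\mathcal{I}_{\mathcal{Y}}\}$, $\mathcal{I}_{\mathcal{Y}}=\{1,\dots,p\}$, is a polyhedral proper $D$-set and this representation is irreducible (no inequality is redundant). - $\mathcal{W}=\{w\in\mathbb{R}^n: e_i^\top w\le 1\ \forall i\in\mathcal{I}_{\mathcal{W}}\}$, $\mathcal{I}_{\mathcal{W}}=\{1,\dots,q\}$, is a polytopic proper $C$-set and this representation is irreducible. - $Q\in\mathbb{R}^{n\times n}$ and $R\in\mathbb{R}^{m\times m}$ are symmetric positive definite. - $K_{\mathcal{S}}\in\mathbb{R}^{m\times n}$ is such that $A+BK_{\mathcal{S}}$ is strictly stable. - $\mathcal{S}=(1-\alpha)^{-1}\bigoplus_{j=0}^{N_{\mathcal{S}}-1}(A+BK_{\mathcal{S}})^j\mathcal{W}$, where $\alpha\in[0,1)$ and $N_{\mathcal{S}}\in\mathbb{N}$ satisfy $(A+BK_{\mathcal{S}})^{N_{\mathcal{S}}}\mathcal{W}\subseteq\alpha\mathcal{W}$. - With $f_i:=h(\mathcal{S},c_i+K_{\mathcal{S}}^\top d_i)$, one has $f_i<1$ for all $i\in\mathcal{I}_{\mathcal{Y}}$. - $\mathcal{Y}_{\mathcal{S}}=\{(z,v): (z+s,v+K_{\mathcal{S}}s)\in\mathcal{Y}\ \forall s\in\mathcal{S}\}$. - $K_{\mathcal{Z}}\in\mathbb{R}^{m\times n}$ is such that $A+BK_{\mathcal{Z}}$ is strictly stable; $\mathcal{Z}_{\mathcal{S}}=\{z: (z,K_{\mathcal{Z}}z)\in\mathcal{Y}_{\mathcal{S}}\}$.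 - $\mathcal{Z}_f=\bigcap_{j=0}^{N_{\mathcal{Z}}}(A+BK_{\mathcal{Z}})^{-j}\mathcal{Z}_{\mathcal{S}}$, where $N_{\mathcal{Z}}\in\mathbb{N}$ satisfies $\bigcap_{j=0}^{N_{\mathcal{Z}}}(A+BK_{\mathcal{Z}})^{-j}\mathcal{Z}_{\mathcal{S}}\subseteq(A+BK_{\mathcal{Z}})^{-(N_{\mathcal{Z}}+1)}\mathcal{Z}_{\mathcal{S}}$. - $P\in\mathbb{R}^{n\times n}$ is symmetric positive definite with $(A+BK_{\mathcal{Z}})^\top P(A+BK_{\mathcal{Z}})-P\preceq-(Q+K_{\mathcal{Z}}^\top RK_{\mathcal{Z}})$. Put $Q_{\mathcal{Z}}:=Q+K_{\mathcal{Z}}^\top RK_{\mathcal{Z}}$. Problem $\mathfrak{P}_T(x)$. $T=(N,N_{\mathcal{S}},N_{\mathcal{Z}})$. The decision variable is $\mathbf{d}_T=(\mathbf{z}_{N-1},\mathbf{v}_{N-1},\mathbf{z}_{[N:N+N_{\mathcal{Z}}]},\boldsymbol{\omega}_{N_{\mathcal{S}}-1})$ with $\mathbf{z}_{N-1}=\{z_k\}_{k=0}^{N-1}$, $\mathbf{v}_{N-1}=\{v_k\}_{k=0}^{N-1}$, $\mathbf{z}_{[N:N+N_{\mathcal{Z}}]}=\{z_k\}_{k=N}^{N+N_{\mathcal{Z}}}$, $\boldsymbol{\omega}_{N_{\mathcal{S}}-1}=\{\omega_k\}_{k=0}^{N_{\mathcal{S}}-1}$, where $z_k,\omega_k\in\mathbb{R}^n$,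 $v_k\in\mathbb{R}^m$. The cost is $$V_T(\mathbf{d}_T)=\sum_{k=0}^{N-1}(z_k^\top Qz_k+v_k^\top Rv_k)+\sum_{k=N}^{N+N_{\mathcal{Z}}-1}z_k^\top Q_{\mathcal{Z}}z_k+z_{N+N_{\mathcal{Z}}}^\top Pz_{N+N_{\mathcal{Z}}}.$$ For $x\in\mathbb{R}^n$, $\mathfrak{P}_T(x)$ is: minimize $V_T(\mathbf{d}_T)$ over $\mathbf{d}_T$ subject to (a) $x=z_0+(1-\alpha)^{-1}\sum_{j=0}^{N_{\mathcal{S}}-1}(A+BK_{\mathcal{S}})^j\omega_j$; (b) $e_i^\top\omega_j\le1$ for all $j\in\mathbb{N}_{N_{\mathcal{S}}-1}$, $i\in\mathcal{I}_{\mathcal{W}}$; (c) $z_{k+1}=Az_k+Bv_k$ for all $k\in\mathbb{N}_{N-1}$; (d) $c_i^\top z_k+d_i^\top v_k\le1-f_i$ for all $k\in\mathbb{N}_{N-1}$, $i\in\mathcal{I}_{\mathcal{Y}}$; (e) $z_{N+k+1}=(A+BK_{\mathcal{Z}})z_{N+k}$ for all $k\in\mathbb{N}_{N_{\mathcal{Z}}-1}$; (f) $(c_i^\top+d_i^\top K_{\mathcal{Z}})z_{N+k}\le1-f_i$ for all $k\in\mathbb{N}_{N_{\mathcal{Z}}}$, $i\in\mathcal{I}_{\mathcal{Y}}$. $\mathcal{C}_T$ (the $T$-controllable set) is the set of $x$ for which (a)-(f) are feasible. For $x\in\mathcal{C}_T$, the $z_k$ and $v_k$ components of a minimizer of $\mathfrak{P}_T(x)$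 are uniquely determined and denoted $z_k^0(x)$, $v_k^0(x)$. Control law. The implicit rigid tube MPC law is $\kappa_T:\mathcal{C}_T\to\mathbb{R}^m$, $\kappa_T(x)=v_0^0(x)+K_{\mathcal{S}}(x-z_0^0(x))$. Robust exponential stability. A closed set $\mathcal{S}$ is robustly exponentially stable for $x^+\in f(x)\oplus\mathcal{W}$ with domain of attraction $\mathcal{C}\supseteq\mathcal{S}$ if there exist $c\in(0,\infty)$ and $\lambda\in(0,1)$ such that every sequence $\{x_k\}_{k\in\mathbb{N}}$ with $x_0\in\mathcal{C}$ and $x_{k+1}\in f(x_k)\oplus\mathcal{W}$ for all $k$ remains in $\mathcal{C}$ and satisfies $\operatorname{distance}(\mathcal{S},x_k)\le c\lambda^k\operatorname{distance}(\mathcal{S},x_0)$ for all $k\in\mathbb{N}$; here $\mathcal{C}_T$ is robust positively invariant, so trajectories from $\mathcal{C}_T$ are defined for all times. The following is a sufficient condition: $\mathcal{S}\subset\operatorname{interior}(\mathcal{C})$ are nonempty closed robust positively invariant sets, and there exist $V:\mathcal{C}\to\mathbb{R}$ and $\gamma_1,\gamma_2\in(0,\infty)$ with $\gamma_1\operatorname{distance}(\mathcal{S},x)\le V(x)\le\gamma_2\operatorname{distance}(\mathcal{S},x)$ and $V(x^+)\le V(x)-\gamma_1\operatorname{distance}(\mathcal{S},x)$ for all $x\in\mathcal{C}$ and all $x^+\in f(x)\oplus\mathcal{W}$. *)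

theory Defs
  imports "HOL-Analysis.Analysis" "HOL-Library.Set_Algebras"
begin

section \<open>Matrices\<close>

text \<open>
  On the type \<open>real^'n^'n\<close> the class operations \<open>*\<close> and \<open>^\<close> act componentwise,
  so powers with respect to the matrix product \<open>**\<close> are defined here.
\<close>

primrec matrix_pow :: "real^'n^'n \<Rightarrow> nat \<Rightarrow> real^'n^'n" where
  "matrix_pow M 0 = mat 1"
| "matrix_pow M (Suc k) = M ** matrix_pow M k"

definition complex_eigenvalues :: "real^'n^'n \<Rightarrow> complex set" where
  "complex_eigenvalues M =
     {l. \<exists>v. v \<noteq> 0 \<and> map_matrix complex_of_real M *v v = l *s v}"

definition spectral_radius :: "real^'n^'n \<Rightarrow> real" where
  "spectral_radius M = Max (cmod ` complex_eigenvalues M)"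

definition strictly_stable :: "real^'n^'n \<Rightarrow> bool" where
  "strictly_stable M \<longleftrightarrow> spectral_radius M < 1"

definition strictly_stabilizable :: "real^'n^'n \<Rightarrow> real^'m^'n \<Rightarrow> bool" where
  "strictly_stabilizable A B \<longleftrightarrow> (\<exists>K :: real^'n^'m. strictly_stable (A + B ** K))"

definition sym_pos_def :: "real^'n^'n \<Rightarrow> bool" where
  "sym_pos_def M \<longleftrightarrow> transpose M = M \<and> (\<forall>x. x \<noteq> 0 \<longrightarrow> 0 < x \<bullet> (M *v x))"

definition loewner_le :: "real^'n^'n \<Rightarrow> real^'n^'n \<Rightarrow> bool" where
  "loewner_le M M' \<longleftrightarrow> (\<forall>x. x \<bullet> (M *v x) \<le> x \<bullet> (M' *v x))"


section \<open>Sets\<close>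

definition proper_D_set :: "'a::euclidean_space set \<Rightarrow> bool" where
  "proper_D_set X \<longleftrightarrow> closed X \<and> convex X \<and> 0 \<in> interior X"

definition proper_C_set :: "'a::euclidean_space set \<Rightarrow> bool" where
  "proper_C_set X \<longleftrightarrow> proper_D_set X \<and> bounded X"

definition irreducible_representation :: "'i set \<Rightarrow> ('i \<Rightarrow> 'a set) \<Rightarrow> bool" where
  "irreducible_representation I H \<longleftrightarrow>
     (\<forall>i\<in>I. (\<Inter>j\<in>I - {i}. H j) \<noteq> (\<Inter>j\<in>I. H j))"

text \<open>
  The supremum is real-valued, hence meaningful only when \<open>y\<close> is bounded above on the
  nonempty set \<open>X\<close>; below it is applied to compact sets only.
\<close>

definition support_function :: "'a::real_inner set \<Rightarrow> 'a \<Rightarrow> real" where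
  "support_function X y = (SUP x\<in>X. y \<bullet> x)"

text \<open>
  The sum is the Minkowski sum of sets (whose empty instance is \<open>{0}\<close>).
\<close>

definition rigid_tube_set :: "real^'n^'n \<Rightarrow> real \<Rightarrow> nat \<Rightarrow> (real^'n) set \<Rightarrow> (real^'n) set" where
  "rigid_tube_set M \<alpha> n W =
     (\<lambda>x. inverse (1 - \<alpha>) *\<^sub>R x) ` (\<Sum>j<n. (\<lambda>w. matrix_pow M j *v w) ` W)"

definition tightened_constraints ::
    "((real^'n) \<times> (real^'m)) set \<Rightarrow> real^'n^'m \<Rightarrow> (real^'n) set \<Rightarrow> ((real^'n) \<times> (real^'m)) set" where
  "tightened_constraints Y K S = {(z, v). \<forall>s\<in>S. (z + s, v + K *v s) \<in> Y}"

definition terminal_set :: "real^'n^'n \<Rightarrow> nat \<Rightarrow> (real^'n) set \<Rightarrow> (real^'n) set" where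
  "terminal_set M n Z = (\<Inter>j\<le>n. (\<lambda>z. matrix_pow M j *v z) -` Z)"


section \<open>The optimal control problem\<close>

text \<open>
  The finite sequences \<open>z\<^sub>0, \<dots>, z\<^bsub>N+NZ\<^esub>\<close>, \<open>v\<^sub>0, \<dots>, v\<^bsub>N-1\<^esub>\<close> and \<open>\<omega>\<^sub>0, \<dots>, \<omega>\<^bsub>NS-1\<^esub>\<close> are represented
  by functions on \<open>nat\<close>; values outside these index ranges enter neither the
  constraints nor the cost.
\<close>

definition tube_cost ::
    "real^'n^'n \<Rightarrow> real^'m^'m \<Rightarrow> real^'n^'n \<Rightarrow> real^'n^'m \<Rightarrow> nat \<Rightarrow> nat \<Rightarrow>
     (nat \<Rightarrow> real^'n) \<Rightarrow> (nat \<Rightarrow> real^'m) \<Rightarrow> real" where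
  "tube_cost Q R P KZ N NZ z v =
     (\<Sum>k<N. z k \<bullet> (Q *v z k) + v k \<bullet> (R *v v k))
     + (\<Sum>k=N..<N + NZ. z k \<bullet> ((Q + transpose KZ ** R ** KZ) *v z k))
     + z (N + NZ) \<bullet> (P *v z (N + NZ))"

definition tube_feasible ::
    "real^'n^'n \<Rightarrow> real^'m^'n \<Rightarrow> nat \<Rightarrow> (nat \<Rightarrow> real^'n) \<Rightarrow> (nat \<Rightarrow> real^'m) \<Rightarrow> (nat \<Rightarrow> real) \<Rightarrow>
     nat \<Rightarrow> (nat \<Rightarrow> real^'n) \<Rightarrow> real^'n^'m \<Rightarrow> real \<Rightarrow> real^'n^'m \<Rightarrow> nat \<Rightarrow> nat \<Rightarrow> nat \<Rightarrow>
     real^'n \<Rightarrow> (nat \<Rightarrow> real^'n) \<Rightarrow> (nat \<Rightarrow> real^'m) \<Rightarrow> (nat \<Rightarrow> real^'n) \<Rightarrow> bool" where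
  "tube_feasible A B p c d f q e KS \<alpha> KZ N NS NZ x z v \<omega> \<longleftrightarrow>
     x = z 0 + inverse (1 - \<alpha>) *\<^sub>R (\<Sum>j<NS. matrix_pow (A + B ** KS) j *v \<omega> j) \<and>
     (\<forall>j<NS. \<forall>i\<in>{1..q}. e i \<bullet> \<omega> j \<le> 1) \<and>
     (\<forall>k<N. z (k + 1) = A *v z k + B *v v k) \<and>
     (\<forall>k<N. \<forall>i\<in>{1..p}. c i \<bullet> z k + d i \<bullet> v k \<le> 1 - f i) \<and>
     (\<forall>k<NZ. z (N + k + 1) = (A + B ** KZ) *v z (N + k)) \<and>
     (\<forall>k\<le>NZ. \<forall>i\<in>{1..p}. (c i + transpose KZ *v d i) \<bullet> z (N + k) \<le> 1 - f i)"

definition controllable_set ::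
    "real^'n^'n \<Rightarrow> real^'m^'n \<Rightarrow> nat \<Rightarrow> (nat \<Rightarrow> real^'n) \<Rightarrow> (nat \<Rightarrow> real^'m) \<Rightarrow> (nat \<Rightarrow> real) \<Rightarrow>
     nat \<Rightarrow> (nat \<Rightarrow> real^'n) \<Rightarrow> real^'n^'m \<Rightarrow> real \<Rightarrow> real^'n^'m \<Rightarrow> nat \<Rightarrow> nat \<Rightarrow> nat \<Rightarrow>
     (real^'n) set" where
  "controllable_set A B p c d f q e KS \<alpha> KZ N NS NZ =
     {x. \<exists>z v \<omega>. tube_feasible A B p c d f q e KS \<alpha> KZ N NS NZ x z v \<omega>}"

definition tube_minimizer ::
    "real^'n^'n \<Rightarrow> real^'m^'n \<Rightarrow> nat \<Rightarrow> (nat \<Rightarrow> real^'n) \<Rightarrow> (nat \<Rightarrow> real^'m) \<Rightarrow> (nat \<Rightarrow> real) \<Rightarrow>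
     nat \<Rightarrow> (nat \<Rightarrow> real^'n) \<Rightarrow> real^'n^'m \<Rightarrow> real \<Rightarrow> real^'n^'m \<Rightarrow> nat \<Rightarrow> nat \<Rightarrow> nat \<Rightarrow>
     real^'n^'n \<Rightarrow> real^'m^'m \<Rightarrow> real^'n^'n \<Rightarrow>
     real^'n \<Rightarrow> (nat \<Rightarrow> real^'n) \<Rightarrow> (nat \<Rightarrow> real^'m) \<Rightarrow> (nat \<Rightarrow> real^'n) \<Rightarrow> bool" where
  "tube_minimizer A B p c d f q e KS \<alpha> KZ N NS NZ Q R P x z v \<omega> \<longleftrightarrow>
     tube_feasible A B p c d f q e KS \<alpha> KZ N NS NZ x z v \<omega> \<and>
     (\<forall>z' v' \<omega>'. tube_feasible A B p c d f q e KS \<alpha> KZ N NS NZ x z' v' \<omega>' \<longrightarrow>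
        tube_cost Q R P KZ N NZ z v \<le> tube_cost Q R P KZ N NZ z' v')"

text \<open>
  A minimizer need not be unique in its \<open>\<omega>\<close> component, but on the controllable set its
  entries \<open>z k\<close> for \<open>k \<le> N + NZ\<close> and \<open>v k\<close> for \<open>k < N\<close> are, by strict convexity of the cost in
  \<open>(z, v)\<close>. The description operators below are meant for these arguments only.
\<close>

definition optimal_z ::
    "real^'n^'n \<Rightarrow> real^'m^'n \<Rightarrow> nat \<Rightarrow> (nat \<Rightarrow> real^'n) \<Rightarrow> (nat \<Rightarrow> real^'m) \<Rightarrow> (nat \<Rightarrow> real) \<Rightarrow>
     nat \<Rightarrow> (nat \<Rightarrow> real^'n) \<Rightarrow> real^'n^'m \<Rightarrow> real \<Rightarrow> real^'n^'m \<Rightarrow> nat \<Rightarrow> nat \<Rightarrow> nat \<Rightarrow>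
     real^'n^'n \<Rightarrow> real^'m^'m \<Rightarrow> real^'n^'n \<Rightarrow> nat \<Rightarrow> real^'n \<Rightarrow> real^'n" where
  "optimal_z A B p c d f q e KS \<alpha> KZ N NS NZ Q R P k x =
     (THE y. \<exists>z v \<omega>. tube_minimizer A B p c d f q e KS \<alpha> KZ N NS NZ Q R P x z v \<omega> \<and> y = z k)"

definition optimal_v ::
    "real^'n^'n \<Rightarrow> real^'m^'n \<Rightarrow> nat \<Rightarrow> (nat \<Rightarrow> real^'n) \<Rightarrow> (nat \<Rightarrow> real^'m) \<Rightarrow> (nat \<Rightarrow> real) \<Rightarrow>
     nat \<Rightarrow> (nat \<Rightarrow> real^'n) \<Rightarrow> real^'n^'m \<Rightarrow> real \<Rightarrow> real^'n^'m \<Rightarrow> nat \<Rightarrow> nat \<Rightarrow> nat \<Rightarrow>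
     real^'n^'n \<Rightarrow> real^'m^'m \<Rightarrow> real^'n^'n \<Rightarrow> nat \<Rightarrow> real^'n \<Rightarrow> real^'m" where
  "optimal_v A B p c d f q e KS \<alpha> KZ N NS NZ Q R P k x =
     (THE y. \<exists>z v \<omega>. tube_minimizer A B p c d f q e KS \<alpha> KZ N NS NZ Q R P x z v \<omega> \<and> y = v k)"

definition tube_mpc_law ::
    "real^'n^'n \<Rightarrow> real^'m^'n \<Rightarrow> nat \<Rightarrow> (nat \<Rightarrow> real^'n) \<Rightarrow> (nat \<Rightarrow> real^'m) \<Rightarrow> (nat \<Rightarrow> real) \<Rightarrow>
     nat \<Rightarrow> (nat \<Rightarrow> real^'n) \<Rightarrow> real^'n^'m \<Rightarrow> real \<Rightarrow> real^'n^'m \<Rightarrow> nat \<Rightarrow> nat \<Rightarrow> nat \<Rightarrow>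
     real^'n^'n \<Rightarrow> real^'m^'m \<Rightarrow> real^'n^'n \<Rightarrow> real^'n \<Rightarrow> real^'m" where
  "tube_mpc_law A B p c d f q e KS \<alpha> KZ N NS NZ Q R P x =
     optimal_v A B p c d f q e KS \<alpha> KZ N NS NZ Q R P 0 x
     + KS *v (x - optimal_z A B p c d f q e KS \<alpha> KZ N NS NZ Q R P 0 x)"


section \<open>Robust exponential stability\<close>

text \<open>
  The map \<open>F\<close> is total, but only its values on \<open>C\<close> matter: trajectories start in \<open>C\<close> and are
  required to remain there, which in particular makes \<open>C\<close> robust positively invariant.
\<close>

definition robustly_exponentially_stable ::
    "('a::real_normed_vector) set \<Rightarrow> ('a \<Rightarrow> 'a) \<Rightarrow> 'a set \<Rightarrow> 'a set \<Rightarrow> bool" where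
  "robustly_exponentially_stable S F W C \<longleftrightarrow>
     closed S \<and> S \<subseteq> C \<and>
     (\<exists>c r :: real. 0 < c \<and> 0 < r \<and> r < 1 \<and>
        (\<forall>x :: nat \<Rightarrow> 'a.
           x 0 \<in> C \<and> (\<forall>k. x (Suc k) \<in> {F (x k)} + W) \<longrightarrow>
           (\<forall>k. x k \<in> C \<and> infdist (x k) S \<le> c * r ^ k * infdist (x 0) S)))"

end

theory Submission
  imports Defs
begin

text \<open>
  Write \<open>x = z\<^sub>0 + s\<close> with \<open>s \<in> S\<close>. Since \<open>(A + B KS) S + W \<subseteq> S\<close>, the shifted optimal nominal trajectory,
  prolonged by \<open>KZ\<close>, is feasible at every successor state, and its cost is smaller by at least
  \<open>z\<^sub>0 \<bullet> Q z\<^sub>0\<close>. The distance of \<open>x\<close> to \<open>S\<close> is at most \<open>norm z\<^sub>0\<close>, so exponential decay follows once the optimal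
  cost is bounded by multiples of \<open>(norm z\<^sub>0)\<^sup>2\<close> and of the squared distance to \<open>S\<close>. As the
  controllable set may be unbounded, such a global bound is not a matter of compactness; it holds
  because the constraints are polyhedral.
\<close>

section \<open>Coercive quadratic forms on finite sequences\<close>

text \<open>The sequences \<open>\<omega>\<close> are eliminated: they only witness
  \<open>x - z\<^sub>0 \<in> S\<close>. What remains is a positive definite quadratic form,
  minimized over nominal trajectories under finitely many linear inequalities and a condition on the
  initial state. The decrease of the optimal cost V is measured by \<open>z\<^sub>0\<close>, the
  claim by the distance to \<open>S\<close>. One estimate, V <= gamma |x - s|^2 for every
  \<open>s \<in> S\<close>, serves both, since \<open>s = x - z\<^sub>0\<close> is admissible: with
  the decrease it makes V contract by a constant factor, so that the distance enters only at time 0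
  and at the time of evaluation. Close to \<open>S\<close> the estimate rests on the slack
  \<open>f i < 1\<close>, which leaves room for a trajectory steered by \<open>KZ\<close>. Far from
  \<open>S\<close> it amounts to linear growth of the solution of a parametric quadratic program,
  obtained here by a limiting argument instead of the piecewise affine solution map.\<close>

lemma componentwise_convergent_subsequence:
  fixes X :: "nat \<Rightarrow> nat \<Rightarrow> 'b::euclidean_space"
  assumes "\<And>n k. k < M \<Longrightarrow> norm (X n k) \<le> C"
  shows "\<exists>l r. strict_mono (r :: nat \<Rightarrow> nat) \<and> (\<forall>k<M. (\<lambda>n. X (r n) k) \<longlonglongrightarrow> l k)"
  using assms
proof (induction M)
  case 0
  show ?case by (auto intro!: exI[of _ id] strict_monoI)
next
  case (Suc M)
  obtain l and r :: "nat \<Rightarrow> nat" where r: "strict_mono r" "\<And>k. k < M \<Longrightarrow> (\<lambda>n. X (r n) k) \<longlonglongrightarrow> l k"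
    using Suc by (metis less_Suc_eq)
  have "bounded (range (\<lambda>n. X (r n) M))"
    using Suc.prems by (auto intro!: boundedI[of _ C])
  then obtain a and s :: "nat \<Rightarrow> nat" where s: "strict_mono s" "((\<lambda>n. X (r n) M) \<circ> s) \<longlonglongrightarrow> a"
    using bounded_imp_convergent_subsequence by blast
  have "(\<lambda>n. X ((r \<circ> s) n) k) \<longlonglongrightarrow> (l(M := a)) k" if "k < Suc M" for k
  proof (cases "k = M")
    case True
    then show ?thesis using s(2) by (simp add: o_def)
  next
    case False
    then have "(\<lambda>n. X (r n) k) \<longlonglongrightarrow> l k" using that r(2) by simp
    then show ?thesis using False LIMSEQ_subseq_LIMSEQ[OF _ s(1)] by (fastforce simp: o_def)
  qed
  moreover have "strict_mono (r \<circ> s)" using r(1) s(1) strict_mono_o by blast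
  ultimately show ?case by blast
qed

text \<open>Sequences are total functions, but only the entries \<open>k < M\<close> count.
  Minimizers are therefore unique only there, and closedness of a set is always tested by
  convergence of these entries alone.\<close>

locale coercive_form =
  fixes M :: nat and G :: "nat \<Rightarrow> 'b::euclidean_space \<Rightarrow> 'b \<Rightarrow> real" and \<mu> :: real
  assumes bilinear: "\<And>k. bounded_bilinear (G k)"
    and sym: "\<And>k x y. G k x y = G k y x"
    and mu_pos: "0 < \<mu>"
    and coercive: "\<And>k x. \<mu> * (norm x)\<^sup>2 \<le> G k x x"
begin

definition form :: "(nat \<Rightarrow> 'b) \<Rightarrow> (nat \<Rightarrow> 'b) \<Rightarrow> real" where
  "form \<xi> \<eta> = (\<Sum>k<M. G k (\<xi> k) (\<eta> k))"

lemma form_sym: "form \<xi> \<eta> = form \<eta> \<xi>"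
  unfolding form_def using sym by (intro sum.cong) auto

lemma form_scale_left: "form (\<lambda>k. t *\<^sub>R \<xi> k) \<eta> = t * form \<xi> \<eta>"
  by (simp add: form_def bounded_bilinear.scaleR_left[OF bilinear] sum_distrib_left)

lemma form_scale_right: "form \<xi> (\<lambda>k. t *\<^sub>R \<eta> k) = t * form \<xi> \<eta>"
  using form_scale_left form_sym by metis

lemma form_scale: "form (\<lambda>k. t *\<^sub>R \<xi> k) (\<lambda>k. t *\<^sub>R \<xi> k) = t\<^sup>2 * form \<xi> \<xi>"
  by (simp add: form_scale_left form_scale_right power2_eq_square)

lemma form_diff:
  "form (\<lambda>k. \<xi> k - \<eta> k) (\<lambda>k. \<xi> k - \<eta> k) = form \<xi> \<xi> - 2 * form \<xi> \<eta> + form \<eta> \<eta>"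
  unfolding form_def sum_distrib_left sum_subtractf[symmetric] sum.distrib[symmetric]
  by (intro sum.cong refl)
     (use sym in \<open>simp add: bounded_bilinear.diff_left[OF bilinear] bounded_bilinear.diff_right[OF bilinear]\<close>)

text \<open>The parallelogram identity, as a quantitative form of strict convexity.\<close>

lemma form_midpoint:
  "form (\<lambda>k. (1/2) *\<^sub>R (\<xi> k + \<eta> k)) (\<lambda>k. (1/2) *\<^sub>R (\<xi> k + \<eta> k))
     = (form \<xi> \<xi> + form \<eta> \<eta>) / 2 - form (\<lambda>k. \<xi> k - \<eta> k) (\<lambda>k. \<xi> k - \<eta> k) / 4"
proof -
  have "form (\<lambda>k. \<xi> k + \<eta> k) (\<lambda>k. \<xi> k + \<eta> k) = form \<xi> \<xi> + 2 * form \<xi> \<eta> + form \<eta> \<eta>"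
    unfolding form_def sum_distrib_left sum_subtractf[symmetric] sum.distrib[symmetric]
    by (intro sum.cong refl)
       (use sym in \<open>simp add: bounded_bilinear.add_left[OF bilinear] bounded_bilinear.add_right[OF bilinear]\<close>)
  then show ?thesis unfolding form_scale form_diff by (simp add: power2_eq_square field_simps)
qed

lemma coercive_form: "k < M \<Longrightarrow> \<mu> * (norm (\<xi> k))\<^sup>2 \<le> form \<xi> \<xi>"
proof -
  assume k: "k < M"
  have "0 \<le> G j x x" for j x
    using coercive[of x j] mu_pos by (meson mult_nonneg_nonneg order_less_imp_le order_trans zero_le_power2)
  then have "G k (\<xi> k) (\<xi> k) \<le> form \<xi> \<xi>"
    unfolding form_def using k by (intro member_le_sum) auto
  then show ?thesis using coercive order_trans by blast
qed

lemma form_nonneg: "0 \<le> form \<xi> \<xi>"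
  unfolding form_def
  by (intro sum_nonneg) (meson coercive mu_pos mult_nonneg_nonneg order_less_imp_le order_trans zero_le_power2)

lemma tendsto_form:
  assumes "\<And>k. k < M \<Longrightarrow> (\<lambda>n. X n k) \<longlonglongrightarrow> l k" "\<And>k. k < M \<Longrightarrow> (\<lambda>n. Y n k) \<longlonglongrightarrow> m k"
  shows "(\<lambda>n. form (X n) (Y n)) \<longlonglongrightarrow> form l m"
  unfolding form_def using assms
  by (intro tendsto_sum bounded_bilinear.tendsto[OF bilinear]) auto

lemma norm_le_of_form_le:
  assumes "form \<xi> \<xi> \<le> K" "k < M"
  shows "norm (\<xi> k) \<le> sqrt (K / \<mu>)"
proof -
  have "(norm (\<xi> k))\<^sup>2 \<le> K / \<mu>"
    using coercive_form[OF assms(2), of \<xi>] assms(1) mu_pos by (simp add: pos_le_divide_eq mult.commute)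
  then show ?thesis by (rule real_le_rsqrt)
qed

text \<open>The direct method: coercivity bounds the entries of a minimizing sequence even when
  \<open>F\<close> is unbounded, and \<open>form\<close> is continuous along the convergent
  subsequence.\<close>

lemma minimizer_exists:
  assumes "F \<noteq> {}"
    and closed: "\<And>X l. (\<And>n. X n \<in> F) \<Longrightarrow> (\<And>k. k < M \<Longrightarrow> (\<lambda>n. X n k) \<longlonglongrightarrow> l k) \<Longrightarrow> l \<in> F"
  obtains \<xi> where "\<xi> \<in> F" "\<And>\<eta>. \<eta> \<in> F \<Longrightarrow> form \<xi> \<xi> \<le> form \<eta> \<eta>"
proof -
  define m where "m = (INF \<xi>\<in>F. form \<xi> \<xi>)"
  have bdd: "bdd_below ((\<lambda>\<xi>. form \<xi> \<xi>) ` F)"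
    using form_nonneg by (intro bdd_belowI2[of _ 0]) auto
  have m_le: "m \<le> form \<xi> \<xi>" if "\<xi> \<in> F" for \<xi>
    unfolding m_def using bdd that by (rule cINF_lower)
  have "\<exists>\<xi>\<in>F. form \<xi> \<xi> < m + inverse (real (Suc n))" for n
    using cINF_less_iff[OF assms(1) bdd, of "m + inverse (real (Suc n))"] by (simp add: m_def)
  then obtain X where X: "\<And>n. X n \<in> F" "\<And>n. form (X n) (X n) < m + inverse (real (Suc n))"
    by metis
  have "inverse (real (Suc n)) \<le> 1" for n by (simp add: field_simps)
  then have "form (X n) (X n) \<le> m + 1" for n using X(2)[of n] by (smt (verit))
  then have "\<And>n k. k < M \<Longrightarrow> norm (X n k) \<le> sqrt ((m + 1) / \<mu>)"
    using norm_le_of_form_le by blast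
  then obtain l and r :: "nat \<Rightarrow> nat" where r: "strict_mono r" "\<And>k. k < M \<Longrightarrow> (\<lambda>n. X (r n) k) \<longlonglongrightarrow> l k"
    using componentwise_convergent_subsequence by metis
  have "l \<in> F" using closed[of "\<lambda>n. X (r n)"] X(1) r(2) by blast
  have "(\<lambda>n. form (X (r n)) (X (r n))) \<longlonglongrightarrow> form l l"
    using r(2) by (intro tendsto_form)
  moreover have "(\<lambda>n. m + inverse (real (Suc (r n)))) \<longlonglongrightarrow> m + 0"
    using LIMSEQ_subseq_LIMSEQ[OF LIMSEQ_inverse_real_of_nat r(1)]
    by (intro tendsto_intros) (simp add: o_def)
  ultimately have "form l l \<le> m + 0"
    using X(2) by (intro LIMSEQ_le) (auto intro: less_imp_le)
  then show ?thesis using that \<open>l \<in> F\<close> m_le by force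
qed

text \<open>The midpoint of two minimizers would have a smaller value unless \<open>form\<close>
  vanishes on their difference, which by coercivity kills the entries \<open>k < M\<close>.\<close>

lemma minimizer_unique:
  assumes "\<xi> \<in> F" "\<eta> \<in> F" "(\<lambda>k. (1/2) *\<^sub>R (\<xi> k + \<eta> k)) \<in> F"
    and "\<And>\<zeta>. \<zeta> \<in> F \<Longrightarrow> form \<xi> \<xi> \<le> form \<zeta> \<zeta>" "\<And>\<zeta>. \<zeta> \<in> F \<Longrightarrow> form \<eta> \<eta> \<le> form \<zeta> \<zeta>"
    and "k < M"
  shows "\<xi> k = \<eta> k"
proof -
  have "form (\<lambda>k. \<xi> k - \<eta> k) (\<lambda>k. \<xi> k - \<eta> k) \<le> 0"
    using assms(4)[OF assms(3)] assms(4)[OF assms(2)] assms(5)[OF assms(1)]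
    unfolding form_midpoint by (simp add: field_simps)
  then have "norm (\<xi> k - \<eta> k) \<le> sqrt (0 / \<mu>)"
    using norm_le_of_form_le[of "\<lambda>k. \<xi> k - \<eta> k", OF _ assms(6)] by blast
  then show ?thesis by simp
qed

text \<open>
  Were the growth faster, the normalized minimizers would accumulate at a direction \<open>l\<close> of
  recession of the constraints with \<open>\<pi> (l 0) = 0\<close>. Since the constraints are polyhedral,
  subtracting \<open>l\<close> from a minimizer far out preserves them and lowers the form.
\<close>

lemma minimizer_linear_growth:
  fixes D :: "(nat \<Rightarrow> 'b) set" and h :: "'i \<Rightarrow> nat \<Rightarrow> 'b" and g :: "'i \<Rightarrow> real"
    and \<pi> :: "'b \<Rightarrow> 'c::real_normed_vector"
  assumes "0 < M" "finite I" and g: "\<And>i. i \<in> I \<Longrightarrow> 0 \<le> g i"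
    and \<pi>: "bounded_linear \<pi>"
    and scale: "\<And>\<xi> t. \<xi> \<in> D \<Longrightarrow> (\<lambda>k. t *\<^sub>R \<xi> k) \<in> D"
    and diff: "\<And>\<xi> \<eta>. \<xi> \<in> D \<Longrightarrow> \<eta> \<in> D \<Longrightarrow> (\<lambda>k. \<xi> k - \<eta> k) \<in> D"
    and closed: "\<And>X l. (\<And>n. X n \<in> D) \<Longrightarrow> (\<And>k. k < M \<Longrightarrow> (\<lambda>n. X n k) \<longlonglongrightarrow> l k) \<Longrightarrow> l \<in> D"
  defines "feas \<equiv> \<lambda>\<xi>. \<xi> \<in> D \<and> (\<forall>k<M. \<forall>i\<in>I. h i k \<bullet> \<xi> k \<le> g i)"
  shows "\<exists>L. \<forall>\<xi>. feas \<xi> \<and> (\<forall>\<eta>. feas \<eta> \<and> \<pi> (\<eta> 0) = \<pi> (\<xi> 0) \<longrightarrow> form \<xi> \<xi> \<le> form \<eta> \<eta>)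
           \<longrightarrow> form \<xi> \<xi> \<le> L * (1 + norm (\<pi> (\<xi> 0)))\<^sup>2"
proof (rule ccontr)
  assume neg: "\<not> ?thesis"
  interpret \<pi>: bounded_linear \<pi> by (rule \<pi>)
  \<comment> \<open>The constant \<open>L\<close> is refuted at
    \<open>(real (Suc n))\<^sup>2\<close>. The summand 1 in the bound forces
    \<open>\<sigma> n\<close> to infinity even if \<open>\<pi> (X n 0)\<close> stays bounded, so
    that division by \<open>\<sigma> n\<close> removes both the bounds \<open>g i\<close> and the
    projection in the limit.\<close>
  have "\<exists>\<xi>. feas \<xi> \<and> (\<forall>\<eta>. feas \<eta> \<and> \<pi> (\<eta> 0) = \<pi> (\<xi> 0) \<longrightarrow> form \<xi> \<xi> \<le> form \<eta> \<eta>)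
           \<and> (real (Suc n))\<^sup>2 * (1 + norm (\<pi> (\<xi> 0)))\<^sup>2 < form \<xi> \<xi>" for n
    using neg by (meson not_le)
  then obtain X where X: "\<And>n. feas (X n)"
    and opt: "\<And>n \<eta>. feas \<eta> \<Longrightarrow> \<pi> (\<eta> 0) = \<pi> (X n 0) \<Longrightarrow> form (X n) (X n) \<le> form \<eta> \<eta>"
    and big: "\<And>n. (real (Suc n))\<^sup>2 * (1 + norm (\<pi> (X n 0)))\<^sup>2 < form (X n) (X n)"
    by metis
  define \<sigma> where "\<sigma> n = sqrt (form (X n) (X n))" for n
  have \<sigma>_big: "real (Suc n) * (1 + norm (\<pi> (X n 0))) < \<sigma> n" for n
    unfolding \<sigma>_def using big[of n]
    by (intro real_less_rsqrt) (simp add: power_mult_distrib)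
  have \<sigma>_gt: "real (Suc n) < \<sigma> n" for n
  proof -
    have "real (Suc n) * 1 \<le> real (Suc n) * (1 + norm (\<pi> (X n 0)))"
      by (intro mult_left_mono) auto
    then show ?thesis using \<sigma>_big[of n] unfolding mult_1_right by (rule le_less_trans)
  qed
  have \<sigma>_pos: "0 < \<sigma> n" for n using \<sigma>_gt[of n] by linarith
  define U where "U n k = inverse (\<sigma> n) *\<^sub>R X n k" for n k
  have XU: "X n k = \<sigma> n *\<^sub>R U n k" for n k
    using \<sigma>_pos[of n] by (simp add: U_def)
  have U1: "form (U n) (U n) = 1" for n
  proof -
    have "form (X n) (X n) = (\<sigma> n)\<^sup>2" by (simp add: \<sigma>_def form_nonneg)
    then have "form (U n) (U n) = (inverse (\<sigma> n))\<^sup>2 * (\<sigma> n)\<^sup>2"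
      by (simp add: U_def[abs_def] form_scale)
    then show ?thesis using \<sigma>_pos[of n] by (simp flip: power_mult_distrib)
  qed
  have "\<And>n k. k < M \<Longrightarrow> norm (U n k) \<le> sqrt (1 / \<mu>)"
    using norm_le_of_form_le U1 by (metis order_refl)
  then obtain l and r :: "nat \<Rightarrow> nat" where r: "strict_mono r" "\<And>k. k < M \<Longrightarrow> (\<lambda>n. U (r n) k) \<longlonglongrightarrow> l k"
    using componentwise_convergent_subsequence by metis
  have U_D: "U n \<in> D" for n
    using scale[of "X n" "inverse (\<sigma> n)"] X[of n] by (simp add: feas_def U_def[abs_def])
  then have l_D: "l \<in> D" using closed[of "\<lambda>n. U (r n)"] r(2) by blast
  have "(\<lambda>n. form (U (r n)) (U (r n))) \<longlonglongrightarrow> form l l" using r(2) by (intro tendsto_form)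
  then have l1: "form l l = 1" using U1 by (simp add: LIMSEQ_const_iff)
  have inv_lim: "(\<lambda>n. inverse (real (Suc (r n)))) \<longlonglongrightarrow> 0"
    using LIMSEQ_subseq_LIMSEQ[OF LIMSEQ_inverse_real_of_nat r(1)] by (simp add: o_def)
  have \<sigma>_inv: "inverse (\<sigma> n) \<le> inverse (real (Suc n))" for n
    using \<sigma>_gt[of n] by (intro le_imp_inverse_le) auto
  have \<sigma>_lim: "(\<lambda>n. inverse (\<sigma> (r n))) \<longlonglongrightarrow> 0"
    by (rule tendsto_sandwich[OF _ _ tendsto_const inv_lim])
       (use \<sigma>_inv \<sigma>_pos in \<open>auto intro!: always_eventually less_imp_le\<close>)
  have \<sigma>_top: "filterlim (\<lambda>n. \<sigma> (r n)) at_top sequentially"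
  proof -
    have "filterlim (\<lambda>n. inverse (inverse (\<sigma> (r n)))) at_top sequentially"
      by (rule filterlim_inverse_at_top[OF \<sigma>_lim]) (simp add: \<sigma>_pos)
    then show ?thesis by simp
  qed
  have \<pi>l: "\<pi> (l 0) = 0"
  proof -
    have "norm (\<pi> (U n 0)) \<le> inverse (real (Suc n))" for n
    proof -
      have "real (Suc n) * norm (\<pi> (X n 0)) \<le> \<sigma> n"
        using \<sigma>_big[of n] by (simp add: algebra_simps)
      then show ?thesis
        using \<sigma>_pos[of n] by (simp add: U_def \<pi>.scaleR divide_simps mult.commute)
    qed
    then have "(\<lambda>n. \<pi> (U (r n) 0)) \<longlonglongrightarrow> 0"
      by (intro Lim_null_comparison[OF always_eventually inv_lim]) blast
    moreover have "(\<lambda>n. \<pi> (U (r n) 0)) \<longlonglongrightarrow> \<pi> (l 0)"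
      using r(2) assms(1) \<pi>.tendsto by blast
    ultimately show ?thesis using LIMSEQ_unique by blast
  qed
  \<comment> \<open>A constraint with \<open>h i k \<bullet> l k = 0\<close> does not notice the
    subtraction of \<open>l\<close>. If the product is negative,
    \<open>h i k \<bullet> X (r n) k\<close> tends to minus infinity at the rate of
    \<open>\<sigma>\<close>; once it is below \<open>h i k \<bullet> l k\<close> the difference is
    at most \<open>0 \<le> g i\<close>.\<close>
  have step: "\<forall>\<^sub>F n in sequentially. h i k \<bullet> (X (r n) k - l k) \<le> g i" if ki: "k < M" "i \<in> I" for k i
  proof -
    have lim: "(\<lambda>n. h i k \<bullet> U (r n) k) \<longlonglongrightarrow> h i k \<bullet> l k"
      using r(2) ki(1) by (intro tendsto_intros)
    have Xg: "h i k \<bullet> X n k \<le> g i" for n using X[of n] ki by (simp add: feas_def)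
    have "h i k \<bullet> U n k \<le> inverse (\<sigma> n) * g i" for n
      using Xg[of n] \<sigma>_pos[of n] by (simp add: U_def mult_left_mono)
    moreover have "(\<lambda>n. inverse (\<sigma> (r n)) * g i) \<longlonglongrightarrow> 0 * g i"
      using \<sigma>_lim by (intro tendsto_intros)
    ultimately have "h i k \<bullet> l k \<le> 0 * g i"
      using lim by (intro LIMSEQ_le[of "\<lambda>n. h i k \<bullet> U (r n) k"]) auto
    then consider "h i k \<bullet> l k = 0" | "h i k \<bullet> l k < 0" by fastforce
    then show ?thesis
    proof cases
      case 1
      then show ?thesis using Xg by (simp add: inner_diff_right)
    next
      case 2
      then have "\<forall>\<^sub>F n in sequentially. h i k \<bullet> U (r n) k < (h i k \<bullet> l k) / 2"
        using lim by (intro order_tendstoD(2)) auto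
      moreover have "\<forall>\<^sub>F n in sequentially. 2 \<le> \<sigma> (r n)"
        using \<sigma>_top unfolding filterlim_at_top by blast
      ultimately show ?thesis
      proof eventually_elim
        case (elim n)
        have "\<sigma> (r n) * (h i k \<bullet> U (r n) k) \<le> \<sigma> (r n) * ((h i k \<bullet> l k) / 2)"
          using elim by (intro mult_left_mono) auto
        also have "\<dots> \<le> 2 * ((h i k \<bullet> l k) / 2)"
          using elim 2 by (intro mult_right_mono_neg) auto
        finally show ?case using g[OF ki(2)] by (simp add: XU inner_diff_right)
      qed
    qed
  qed
  have "\<forall>\<^sub>F n in sequentially. \<forall>k\<in>{..<M}. \<forall>i\<in>I. h i k \<bullet> (X (r n) k - l k) \<le> g i"
    using step assms(2) by (intro eventually_ball_finite ballI) auto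
  moreover have "\<forall>\<^sub>F n in sequentially. 1/2 < form (U (r n)) l"
    using tendsto_form[of "\<lambda>n. U (r n)" l "\<lambda>n. l" l] r(2) l1 by (intro order_tendstoD(1)) auto
  moreover have "\<forall>\<^sub>F n in sequentially. 1 \<le> \<sigma> (r n)"
    using \<sigma>_top unfolding filterlim_at_top by blast
  ultimately have "\<forall>\<^sub>F n in sequentially. False"
  proof eventually_elim
    case (elim n)
    \<comment> \<open>The cross term \<open>form (X (r n)) l\<close> carries the factor
      \<open>\<sigma> (r n) \<ge> 1\<close> and \<open>form (U (r n)) l > 1/2\<close>, so twice it
      exceeds \<open>form l l = 1\<close> and \<open>\<eta>\<close> beats the minimizer.\<close>
    define \<eta> where "\<eta> k = X (r n) k - l k" for k
    have "feas \<eta>" using elim diff[OF _ l_D] X[of "r n"] by (auto simp: feas_def \<eta>_def[abs_def])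
    then have "form (X (r n)) (X (r n)) \<le> form \<eta> \<eta>"
      using \<pi>l by (intro opt) (simp_all add: \<eta>_def \<pi>.diff)
    also have "\<dots> = form (X (r n)) (X (r n)) - 2 * form (X (r n)) l + 1"
      unfolding \<eta>_def form_diff l1 ..
    also have "form (X (r n)) l = \<sigma> (r n) * form (U (r n)) l"
      by (simp add: form_scale_left[symmetric] XU[symmetric])
    finally have "2 * (\<sigma> (r n) * form (U (r n)) l) \<le> 1" by simp
    moreover have "1 * (1/2) < \<sigma> (r n) * form (U (r n)) l"
      using elim by (intro mult_le_less_imp_less) auto
    ultimately show ?case by simp
  qed
  then show False by simp
qed

end

section \<open>Quadratic forms of matrices\<close>

text \<open>The constant is the minimum of the form on the unit sphere; homogeneity extends the
  bound.\<close>

lemma sym_pos_def_coercive: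
  fixes H :: "real^'n^'n"
  assumes "sym_pos_def H"
  obtains \<mu> where "0 < \<mu>" "\<And>x. \<mu> * (norm x)\<^sup>2 \<le> x \<bullet> (H *v x)"
proof -
  let ?S = "sphere (0::real^'n) 1"
  have "continuous_on ?S (\<lambda>x. x \<bullet> (H *v x))"
    by (intro continuous_on_inner continuous_on_id linear_continuous_on matrix_vector_mul_bounded_linear)
  moreover have "?S \<noteq> {}"
    using vector_choose_size[of 1, where 'a = "real^'n"] by (metis dist_0_norm empty_iff mem_sphere zero_le_one)
  ultimately obtain u where u: "u \<in> ?S" "\<And>x. x \<in> ?S \<Longrightarrow> u \<bullet> (H *v u) \<le> x \<bullet> (H *v x)"
    using continuous_attains_inf[OF compact_sphere, of 0 1 "\<lambda>x. x \<bullet> (H *v x)"] by blast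
  have "(u \<bullet> (H *v u)) * (norm x)\<^sup>2 \<le> x \<bullet> (H *v x)" for x
  proof (cases "x = 0")
    case False
    then have "u \<bullet> (H *v u) \<le> sgn x \<bullet> (H *v sgn x)"
      by (intro u(2)) (simp add: norm_sgn)
    then show ?thesis
      using False by (simp add: sgn_div_norm matrix_vector_mult_scaleR power2_eq_square field_simps)
  qed simp
  moreover have "0 < u \<bullet> (H *v u)"
    using assms u(1) unfolding sym_pos_def_def by (metis mem_sphere dist_self zero_neq_one)
  ultimately show ?thesis using that by blast
qed

lemma sym_pos_def_inner_commute:
  assumes "sym_pos_def H"
  shows "x \<bullet> (H *v y) = y \<bullet> (H *v x)"
  using assms by (metis sym_pos_def_def dot_lmul_matrix inner_commute transpose_matrix_vector)

lemma sym_pos_def_mat_1: "sym_pos_def (mat 1 :: real^'n^'n)"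
  by (simp add: sym_pos_def_def)

lemma inner_transpose_mult:
  fixes K :: "real^'n^'m"
  shows "(transpose K *v y) \<bullet> x = y \<bullet> (K *v x)"
  by (simp add: dot_lmul_matrix transpose_matrix_vector)

lemma inner_congruence:
  fixes K :: "real^'n^'m"
  shows "x \<bullet> ((transpose K ** H ** K) *v y) = (K *v x) \<bullet> (H *v (K *v y))"
  by (metis inner_commute inner_transpose_mult matrix_vector_mul_assoc)

lemma sym_pos_def_add_congruence:
  fixes H :: "real^'n^'n" and K :: "real^'n^'m"
  assumes "sym_pos_def H" "sym_pos_def R"
  shows "sym_pos_def (H + transpose K ** R ** K)"
proof -
  have "0 \<le> y \<bullet> (R *v y)" for y
    using assms(2) by (cases "y = 0") (auto simp: sym_pos_def_def less_imp_le)
  moreover have "transpose (H + transpose K ** R ** K) = H + transpose K ** R ** K"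
  proof -
    have "transpose (H + transpose K ** R ** K) = transpose H + transpose (transpose K ** R ** K)"
      by (simp add: transpose_def vec_eq_iff)
    then show ?thesis
      using assms by (simp add: sym_pos_def_def matrix_transpose_mul matrix_mul_assoc)
  qed
  ultimately show ?thesis
    using assms(1)
    by (simp add: sym_pos_def_def matrix_vector_mult_add_rdistrib inner_add_right inner_congruence add_pos_nonneg)
qed

lemma bounded_bilinear_inner_matrix:
  "bounded_bilinear (\<lambda>x y. x \<bullet> ((H :: real^'n^'m) *v y))"
  by (rule bounded_bilinear.comp[OF bounded_bilinear_inner bounded_linear_ident matrix_vector_mul_bounded_linear])

lemma quadratic_form_bounded:
  fixes H :: "real^'n^'n"
  shows "\<exists>K>0. \<forall>x. x \<bullet> (H *v x) \<le> K * (norm x)\<^sup>2"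
proof -
  obtain K where "0 < K" "\<And>x y. norm (x \<bullet> (H *v y)) \<le> norm x * norm y * K"
    using bounded_bilinear.pos_bounded[OF bounded_bilinear_inner_matrix[of H]] by blast
  then have "x \<bullet> (H *v x) \<le> K * (norm x)\<^sup>2" for x
    by (metis abs_le_D1 mult.commute power2_eq_square real_norm_def)
  then show ?thesis using \<open>0 < K\<close> by blast
qed

section \<open>Rigid tube MPC\<close>

text \<open>The properties of \<open>S\<close> and of the terminal set appear in the form in which
  the stability argument uses them; they are derived from the explicit constructions at the end.
  \<open>terminal_invariant\<close> is the inclusion that characterizes \<open>NZ\<close>, written
  out in the tightened inequalities.\<close>

locale rigid_tube =
  fixes A :: "real^'n^'n" and B :: "real^'m^'n"
    and p :: nat and c :: "nat \<Rightarrow> real^'n" and d :: "nat \<Rightarrow> real^'m"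
    and q :: nat and e :: "nat \<Rightarrow> real^'n"
    and Q P :: "real^'n^'n" and R :: "real^'m^'m"
    and KS KZ :: "real^'n^'m"
    and \<alpha> :: real and N NS NZ :: nat
    and W S :: "(real^'n) set"
    and f :: "nat \<Rightarrow> real"
  assumes Q_pos_def: "sym_pos_def Q"
    and R_pos_def: "sym_pos_def R"
    and P_pos_def: "sym_pos_def P"
    and P_lyapunov: "loewner_le (transpose (A + B ** KZ) ** P ** (A + B ** KZ) - P)
                       (- (Q + transpose KZ ** R ** KZ))"
    and f_less_1: "\<And>i. i \<in> {1..p} \<Longrightarrow> f i < 1"
    and N_pos: "N \<ge> 1"
    and terminal_invariant: "\<And>z i. \<lbrakk>\<And>j i. j \<le> NZ \<Longrightarrow> i \<in> {1..p} \<Longrightarrow>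
            (c i + transpose KZ *v d i) \<bullet> (matrix_pow (A + B ** KZ) j *v z) \<le> 1 - f i; i \<in> {1..p}\<rbrakk>
          \<Longrightarrow> (c i + transpose KZ *v d i) \<bullet> (matrix_pow (A + B ** KZ) (NZ + 1) *v z) \<le> 1 - f i"
    and mem_S_iff: "\<And>s. s \<in> S \<longleftrightarrow> (\<exists>\<omega>. (\<forall>j<NS. \<forall>i\<in>{1..q}. e i \<bullet> \<omega> j \<le> 1) \<and>
          s = inverse (1 - \<alpha>) *\<^sub>R (\<Sum>j<NS. matrix_pow (A + B ** KS) j *v \<omega> j))"
    and compact_S: "compact S" and convex_S: "convex S" and zero_S: "0 \<in> S"
    and S_invariant: "\<And>s w. s \<in> S \<Longrightarrow> w \<in> W \<Longrightarrow> (A + B ** KS) *v s + w \<in> S"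
begin

section \<open>Encoding of the nominal problem\<close>

definition AZ :: "real^'n^'n" where "AZ = A + B ** KZ"
definition QZ :: "real^'n^'n" where "QZ = Q + transpose KZ ** R ** KZ"

definition state_weight :: "nat \<Rightarrow> real^'n^'n" where
  "state_weight k = (if k < N then Q else if k < N + NZ then QZ else P)"

definition input_weight :: "nat \<Rightarrow> real^'m^'m" where
  "input_weight k = (if k < N then R else mat 1)"

text \<open>
  A nominal trajectory is encoded by \<open>\<xi> k = (z k, v k)\<close> for \<open>k \<le> N + NZ\<close>. The inputs \<open>v k\<close> with
  \<open>N \<le> k\<close> are spurious; weighting them by the identity makes the cost coercive in \<open>\<xi>\<close>.
\<close>

definition stage :: "nat \<Rightarrow> (real^'n) \<times> (real^'m) \<Rightarrow> (real^'n) \<times> (real^'m) \<Rightarrow> real" where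
  "stage k a b = fst a \<bullet> (state_weight k *v fst b) + snd a \<bullet> (input_weight k *v snd b)"

definition dyn :: "(nat \<Rightarrow> (real^'n) \<times> (real^'m)) \<Rightarrow> bool" where
  "dyn \<xi> \<longleftrightarrow> (\<forall>k<N. fst (\<xi> (Suc k)) = A *v fst (\<xi> k) + B *v snd (\<xi> k)) \<and>
     (\<forall>k. N \<le> k \<and> k < N + NZ \<longrightarrow> fst (\<xi> (Suc k)) = AZ *v fst (\<xi> k))"

text \<open>From index \<open>N\<close> on the feedback \<open>KZ\<close> is folded into the state
  part, so the spurious inputs are left unconstrained.\<close>

definition normal :: "nat \<Rightarrow> nat \<Rightarrow> (real^'n) \<times> (real^'m)" where
  "normal i k = (if k < N then (c i, d i) else (c i + transpose KZ *v d i, 0))"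

text \<open>Written with \<open>Collect dyn\<close> and \<open>Suc (N + NZ)\<close> so that
  unfolding yields exactly the shape of \<open>minimizer_linear_growth\<close>.\<close>

definition feas :: "(nat \<Rightarrow> (real^'n) \<times> (real^'m)) \<Rightarrow> bool" where
  "feas \<xi> \<longleftrightarrow> \<xi> \<in> Collect dyn \<and> (\<forall>k<Suc (N + NZ). \<forall>i\<in>{1..p}. normal i k \<bullet> \<xi> k \<le> 1 - f i)"

definition feas_at :: "real^'n \<Rightarrow> (nat \<Rightarrow> (real^'n) \<times> (real^'m)) set" where
  "feas_at x = {\<xi>. feas \<xi> \<and> x - fst (\<xi> 0) \<in> S}"

text \<open>Sets the spurious inputs to zero, where their weight costs nothing; on truncated
  sequences \<open>form\<close> is the tube cost.\<close>

definition trunc :: "(nat \<Rightarrow> real^'n) \<Rightarrow> (nat \<Rightarrow> real^'m) \<Rightarrow> nat \<Rightarrow> (real^'n) \<times> (real^'m)" where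
  "trunc z v k = (z k, if k < N then v k else 0)"

abbreviation "C \<equiv> controllable_set A B p c d f q e KS \<alpha> KZ N NS NZ"
abbreviation "law \<equiv> tube_mpc_law A B p c d f q e KS \<alpha> KZ N NS NZ Q R P"
abbreviation "minimizer \<equiv> tube_minimizer A B p c d f q e KS \<alpha> KZ N NS NZ Q R P"
abbreviation "tfeasible \<equiv> tube_feasible A B p c d f q e KS \<alpha> KZ N NS NZ"

section \<open>Positive definiteness of the stage weights\<close>

lemma QZ_pos_def: "sym_pos_def QZ"
  unfolding QZ_def using Q_pos_def R_pos_def by (rule sym_pos_def_add_congruence)

lemma inner_QZ: "x \<bullet> (QZ *v x) = x \<bullet> (Q *v x) + (KZ *v x) \<bullet> (R *v (KZ *v x))"
  by (simp add: QZ_def matrix_vector_mult_add_rdistrib inner_add_right inner_congruence)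

lemma lyapunov_decrease: "(AZ *v x) \<bullet> (P *v (AZ *v x)) + x \<bullet> (QZ *v x) \<le> x \<bullet> (P *v x)"
proof -
  have "x \<bullet> ((transpose AZ ** P ** AZ - P) *v x) \<le> x \<bullet> ((- QZ) *v x)"
    using P_lyapunov by (simp add: loewner_le_def AZ_def QZ_def)
  moreover have "(- QZ) *v x = - (QZ *v x)"
    by (simp add: matrix_vector_mult_def vec_eq_iff sum_negf)
  ultimately show ?thesis
    by (simp add: matrix_vector_mult_diff_rdistrib inner_diff_right inner_congruence)
qed

lemma stage_coercive: "\<exists>\<mu>>0. \<forall>k a. \<mu> * (norm a)\<^sup>2 \<le> stage k a a"
proof -
  obtain m1 where m1: "0 < m1" "\<And>x. m1 * (norm x)\<^sup>2 \<le> x \<bullet> (Q *v x)" using sym_pos_def_coercive[OF Q_pos_def] by blast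
  obtain m2 where m2: "0 < m2" "\<And>x. m2 * (norm x)\<^sup>2 \<le> x \<bullet> (QZ *v x)" using sym_pos_def_coercive[OF QZ_pos_def] by blast
  obtain m3 where m3: "0 < m3" "\<And>x. m3 * (norm x)\<^sup>2 \<le> x \<bullet> (P *v x)" using sym_pos_def_coercive[OF P_pos_def] by blast
  obtain m4 where m4: "0 < m4" "\<And>x. m4 * (norm x)\<^sup>2 \<le> x \<bullet> (R *v x)" using sym_pos_def_coercive[OF R_pos_def] by blast
  \<comment> \<open>The entry 1 accounts for the identity weight on the spurious inputs.\<close>
  define \<mu> where "\<mu> = Min {m1, m2, m3, m4, 1}"
  have \<mu>: "0 < \<mu>" "\<mu> \<le> m1" "\<mu> \<le> m2" "\<mu> \<le> m3" "\<mu> \<le> m4" "\<mu> \<le> 1"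
    using m1 m2 m3 m4 by (auto simp: \<mu>_def)
  have weaken: "\<mu> * (norm y)\<^sup>2 \<le> t" if "\<mu> \<le> m" "m * (norm y)\<^sup>2 \<le> t" for m t and y :: "'z::real_normed_vector"
    using that mult_right_mono[OF that(1), of "(norm y)\<^sup>2"] by (simp add: order_trans)
  have "\<mu> * (norm x)\<^sup>2 \<le> x \<bullet> (state_weight k *v x)" for x k
    using weaken[OF \<mu>(2) m1(2)] weaken[OF \<mu>(3) m2(2)] weaken[OF \<mu>(4) m3(2)]
    by (simp add: state_weight_def)
  moreover have "\<mu> * (norm x)\<^sup>2 \<le> x \<bullet> (input_weight k *v x)" for x k
    using weaken[OF \<mu>(5) m4(2)] weaken[OF \<mu>(6), of x "x \<bullet> x"]
    by (simp add: input_weight_def power2_norm_eq_inner)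
  ultimately have "\<mu> * (norm a)\<^sup>2 \<le> stage k a a" for k a
    by (simp add: stage_def norm_prod_def distrib_left add_mono)
  then show ?thesis using \<mu>(1) by blast
qed

text \<open>A choice, because the sublocale below requires the constant as a term.\<close>

definition \<mu> :: real where
  "\<mu> = (SOME \<mu>. 0 < \<mu> \<and> (\<forall>k a. \<mu> * (norm a)\<^sup>2 \<le> stage k a a))"

lemma \<mu>: "0 < \<mu>" "\<mu> * (norm a)\<^sup>2 \<le> stage k a a"
  using someI_ex[OF stage_coercive] unfolding \<mu>_def by blast+

sublocale coercive_form "Suc (N + NZ)" stage \<mu>
proof (rule coercive_form.intro)
  show "bounded_bilinear (stage k)" for k
  proof -
    have "bounded_linear (\<lambda>b. (state_weight k *v fst b, input_weight k *v snd b))"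
      by (intro bounded_linear_Pair bounded_linear_compose[OF matrix_vector_mul_bounded_linear]
          bounded_linear_fst bounded_linear_snd)
    then have "bounded_bilinear (\<lambda>a b. a \<bullet> (state_weight k *v fst b, input_weight k *v snd b))"
      by (rule bounded_bilinear.comp[OF bounded_bilinear_inner bounded_linear_ident])
    then show ?thesis by (simp add: stage_def[abs_def] inner_prod_def)
  qed
  show "stage k a b = stage k b a" for k a b
  proof -
    have "sym_pos_def (state_weight k)" "sym_pos_def (input_weight k)"
      using Q_pos_def QZ_pos_def P_pos_def R_pos_def
      by (auto simp: state_weight_def input_weight_def sym_pos_def_mat_1)
    then show ?thesis by (simp add: stage_def sym_pos_def_inner_commute)
  qed
qed (rule \<mu>)+

section \<open>Translation between the tube problem and its encoding\<close>

lemma inner_normal: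
  "normal i k \<bullet> a = (if k < N then c i \<bullet> fst a + d i \<bullet> snd a else (c i + transpose KZ *v d i) \<bullet> fst a)"
  by (cases a) (simp add: normal_def)

text \<open>By \<open>mem_S_iff\<close> an admissible \<open>\<omega>\<close> is nothing but a
  witness of \<open>x - z 0 \<in> S\<close>; the remaining constraints correspond index by
  index.\<close>

lemma tfeasible_iff: "(\<exists>\<omega>. tfeasible x z v \<omega>) \<longleftrightarrow> trunc z v \<in> feas_at x"
proof -
  have d: "dyn (trunc z v) \<longleftrightarrow> (\<forall>k<N. z (k + 1) = A *v z k + B *v v k) \<and>
     (\<forall>k<NZ. z (N + k + 1) = (A + B ** KZ) *v z (N + k))"
  proof -
    have "(\<forall>k. N \<le> k \<and> k < N + NZ \<longrightarrow> z (Suc k) = AZ *v z k) \<longleftrightarrow>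
      (\<forall>k<NZ. z (N + k + 1) = (A + B ** KZ) *v z (N + k))"
      unfolding AZ_def[symmetric] by (auto simp: le_iff_add)
    then show ?thesis by (simp add: dyn_def trunc_def)
  qed
  have i: "(\<forall>k<Suc (N + NZ). \<forall>i\<in>{1..p}. normal i k \<bullet> trunc z v k \<le> 1 - f i) \<longleftrightarrow>
     (\<forall>k<N. \<forall>i\<in>{1..p}. c i \<bullet> z k + d i \<bullet> v k \<le> 1 - f i) \<and>
     (\<forall>k\<le>NZ. \<forall>i\<in>{1..p}. (c i + transpose KZ *v d i) \<bullet> z (N + k) \<le> 1 - f i)" (is "?l \<longleftrightarrow> ?r1 \<and> ?r2")
  proof (intro iffI conjI)
    assume l: ?l
    show ?r1
    proof (intro allI impI ballI)
      fix k i assume "k < N" "i \<in> {1..p}"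
      then show "c i \<bullet> z k + d i \<bullet> v k \<le> 1 - f i"
        using l[rule_format, of k i] by (simp add: inner_normal trunc_def)
    qed
    show ?r2
    proof (intro allI impI ballI)
      fix k i assume "k \<le> NZ" "i \<in> {1..p}"
      then show "(c i + transpose KZ *v d i) \<bullet> z (N + k) \<le> 1 - f i"
        using l[rule_format, of "N + k" i] by (simp add: inner_normal trunc_def)
    qed
  next
    assume r: "?r1 \<and> ?r2"
    show ?l
    proof (intro allI impI ballI)
      fix k i assume k: "k < Suc (N + NZ)" "i \<in> {1..p}"
      show "normal i k \<bullet> trunc z v k \<le> 1 - f i"
      proof (cases "k < N")
        case True
        then show ?thesis using r k by (simp add: inner_normal trunc_def)
      next
        case False
        then obtain j where "k = N + j" "j \<le> NZ" using k(1) by (metis add_le_cancel_left le_iff_add less_Suc_eq_le not_less)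
        then show ?thesis using r k by (simp add: inner_normal trunc_def)
      qed
    qed
  qed
  have s: "(\<exists>\<omega>. (\<forall>j<NS. \<forall>i\<in>{1..q}. e i \<bullet> \<omega> j \<le> 1) \<and>
     x = z 0 + inverse (1 - \<alpha>) *\<^sub>R (\<Sum>j<NS. matrix_pow (A + B ** KS) j *v \<omega> j)) \<longleftrightarrow> x - z 0 \<in> S"
    unfolding mem_S_iff by (simp add: algebra_simps)
  have "trunc z v \<in> feas_at x \<longleftrightarrow> ((\<forall>k<N. z (k + 1) = A *v z k + B *v v k) \<and>
     (\<forall>k<NZ. z (N + k + 1) = (A + B ** KZ) *v z (N + k))) \<and>
     (\<forall>k<N. \<forall>i\<in>{1..p}. c i \<bullet> z k + d i \<bullet> v k \<le> 1 - f i) \<and>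
     (\<forall>k\<le>NZ. \<forall>i\<in>{1..p}. (c i + transpose KZ *v d i) \<bullet> z (N + k) \<le> 1 - f i) \<and> x - z 0 \<in> S"
    unfolding feas_at_def feas_def mem_Collect_eq d i by (simp only: trunc_def fst_conv conj_assoc)
  then show ?thesis
    unfolding tube_feasible_def s[symmetric]
    by (simp only:) (intro iffI; elim exE conjE; intro conjI exI; assumption)
qed

lemma cost_trunc: "tube_cost Q R P KZ N NZ z v = form (trunc z v) (trunc z v)"
proof -
  have "(\<Sum>k<N + NZ. stage k (trunc z v k) (trunc z v k))
      = (\<Sum>k<N. stage k (trunc z v k) (trunc z v k)) + (\<Sum>k=N..<N + NZ. stage k (trunc z v k) (trunc z v k))"
    unfolding lessThan_atLeast0 by (simp add: sum.atLeastLessThan_concat)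
  moreover have "(\<Sum>k<N. stage k (trunc z v k) (trunc z v k)) = (\<Sum>k<N. z k \<bullet> (Q *v z k) + v k \<bullet> (R *v v k))"
    by (intro sum.cong) (auto simp: stage_def trunc_def state_weight_def input_weight_def)
  moreover have "(\<Sum>k=N..<N + NZ. stage k (trunc z v k) (trunc z v k)) = (\<Sum>k=N..<N + NZ. z k \<bullet> (QZ *v z k))"
    by (intro sum.cong) (auto simp: stage_def trunc_def state_weight_def input_weight_def)
  moreover have "stage (N + NZ) (trunc z v (N + NZ)) (trunc z v (N + NZ)) = z (N + NZ) \<bullet> (P *v z (N + NZ))"
    by (auto simp: stage_def trunc_def state_weight_def input_weight_def)
  ultimately show ?thesis
    unfolding tube_cost_def form_def by (simp add: QZ_def)
qed

lemma trunc_feas_at: "\<xi> \<in> feas_at x \<Longrightarrow> trunc (fst \<circ> \<xi>) (snd \<circ> \<xi>) \<in> feas_at x"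
  by (auto simp: feas_at_def feas_def dyn_def trunc_def inner_normal)

lemma form_trunc_le: "form (trunc (fst \<circ> \<xi>) (snd \<circ> \<xi>)) (trunc (fst \<circ> \<xi>) (snd \<circ> \<xi>)) \<le> form \<xi> \<xi>"
  unfolding form_def
  by (intro sum_mono) (auto simp: stage_def trunc_def input_weight_def)

definition optimal :: "real^'n \<Rightarrow> (nat \<Rightarrow> (real^'n) \<times> (real^'m)) \<Rightarrow> bool" where
  "optimal x \<xi> \<longleftrightarrow> \<xi> \<in> feas_at x \<and> (\<forall>\<eta>\<in>feas_at x. form \<xi> \<xi> \<le> form \<eta> \<eta>)"

text \<open>Every encoded competitor can be truncated without losing feasibility or raising its
  form, and truncated sequences are exactly what the tube problem compares.\<close>

lemma minimizer_optimal: "minimizer x z v \<omega> \<Longrightarrow> optimal x (trunc z v)"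
  unfolding tube_minimizer_def optimal_def cost_trunc
  by (meson form_trunc_le order_trans tfeasible_iff trunc_feas_at)

lemma optimal_minimizer:
  assumes "optimal x \<xi>"
  shows "\<exists>\<omega>. minimizer x (fst \<circ> \<xi>) (snd \<circ> \<xi>) \<omega>"
proof -
  have "trunc (fst \<circ> \<xi>) (snd \<circ> \<xi>) \<in> feas_at x" using assms trunc_feas_at optimal_def by blast
  then obtain \<omega> where "tfeasible x (fst \<circ> \<xi>) (snd \<circ> \<xi>) \<omega>" using tfeasible_iff by blast
  moreover have "form (trunc (fst \<circ> \<xi>) (snd \<circ> \<xi>)) (trunc (fst \<circ> \<xi>) (snd \<circ> \<xi>)) \<le> form (trunc z v) (trunc z v)"
    if "tfeasible x z v w" for z v w
  proof -
    have "trunc z v \<in> feas_at x" using that tfeasible_iff by blast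
    then have "form \<xi> \<xi> \<le> form (trunc z v) (trunc z v)" using assms by (simp add: optimal_def)
    with form_trunc_le show ?thesis by (rule order_trans)
  qed
  ultimately show ?thesis unfolding tube_minimizer_def cost_trunc by blast
qed

lemma mem_C_iff: "x \<in> C \<longleftrightarrow> feas_at x \<noteq> {}"
  unfolding controllable_set_def using tfeasible_iff trunc_feas_at by blast

section \<open>Existence and uniqueness of optimal trajectories, evaluation of the control
  law\<close>

lemma dyn_closed:
  assumes "\<And>n. dyn (X n)" "\<And>k. k < Suc (N + NZ) \<Longrightarrow> (\<lambda>n. X n k) \<longlonglongrightarrow> l k"
  shows "dyn l"
proof -
  have lin: "(\<lambda>n. H *v Z n) \<longlonglongrightarrow> H *v y" if "Z \<longlonglongrightarrow> y" for H :: "real^'x^'y" and Z y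
    using bounded_linear.tendsto[OF matrix_vector_mul_bounded_linear that] .
  have l1: "fst (l (Suc k)) = A *v fst (l k) + B *v snd (l k)" if "k < N" for k
  proof (rule LIMSEQ_unique)
    show "(\<lambda>n. fst (X n (Suc k))) \<longlonglongrightarrow> fst (l (Suc k))"
      using that by (intro tendsto_intros assms(2)) auto
    have "(\<lambda>n. A *v fst (X n k) + B *v snd (X n k)) \<longlonglongrightarrow> A *v fst (l k) + B *v snd (l k)"
      using that by (intro tendsto_intros lin assms(2)) auto
    then show "(\<lambda>n. fst (X n (Suc k))) \<longlonglongrightarrow> A *v fst (l k) + B *v snd (l k)"
      using assms(1) that by (simp add: dyn_def)
  qed
  have l2: "fst (l (Suc k)) = AZ *v fst (l k)" if "N \<le> k" "k < N + NZ" for k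
  proof (rule LIMSEQ_unique)
    show "(\<lambda>n. fst (X n (Suc k))) \<longlonglongrightarrow> fst (l (Suc k))"
      using that by (intro tendsto_intros assms(2)) auto
    have "(\<lambda>n. AZ *v fst (X n k)) \<longlonglongrightarrow> AZ *v fst (l k)"
      using that by (intro tendsto_intros lin assms(2)) auto
    then show "(\<lambda>n. fst (X n (Suc k))) \<longlonglongrightarrow> AZ *v fst (l k)"
      using assms(1) that by (simp add: dyn_def)
  qed
  show ?thesis using l1 l2 by (simp add: dyn_def)
qed

lemma dyn_scale: "dyn \<xi> \<Longrightarrow> dyn (\<lambda>k. t *\<^sub>R \<xi> k)"
  by (simp add: dyn_def matrix_vector_mult_scaleR scaleR_add_right)

lemma dyn_diff: "dyn \<xi> \<Longrightarrow> dyn \<eta> \<Longrightarrow> dyn (\<lambda>k. \<xi> k - \<eta> k)"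
  by (simp add: dyn_def matrix_vector_mult_diff_distrib)

lemma dyn_add: "dyn \<xi> \<Longrightarrow> dyn \<eta> \<Longrightarrow> dyn (\<lambda>k. \<xi> k + \<eta> k)"
  by (simp add: dyn_def matrix_vector_right_distrib)

lemma feas_at_closed:
  assumes "\<And>n. X n \<in> feas_at x" "\<And>k. k < Suc (N + NZ) \<Longrightarrow> (\<lambda>n. X n k) \<longlonglongrightarrow> l k"
  shows "l \<in> feas_at x"
proof -
  have "dyn l" using dyn_closed[of X l] assms by (simp add: feas_at_def feas_def)
  moreover have "normal i k \<bullet> l k \<le> 1 - f i" if "k < Suc (N + NZ)" "i \<in> {1..p}" for i k
  proof (rule LIMSEQ_le_const2)
    show "(\<lambda>n. normal i k \<bullet> X n k) \<longlonglongrightarrow> normal i k \<bullet> l k"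
      using that by (intro tendsto_intros assms(2))
  qed (use assms(1) that in \<open>auto simp: feas_at_def feas_def\<close>)
  moreover have "x - fst (l 0) \<in> S"
  proof (rule closed_sequentially[OF compact_imp_closed[OF compact_S]])
    show "(\<lambda>n. x - fst (X n 0)) \<longlonglongrightarrow> x - fst (l 0)"
      by (intro tendsto_intros assms(2)) auto
  qed (use assms(1) in \<open>auto simp: feas_at_def\<close>)
  ultimately show ?thesis by (simp add: feas_at_def feas_def)
qed

lemma feas_at_midpoint:
  assumes "\<xi> \<in> feas_at x" "\<eta> \<in> feas_at x"
  shows "(\<lambda>k. (1/2) *\<^sub>R (\<xi> k + \<eta> k)) \<in> feas_at x"
proof -
  have "dyn (\<lambda>k. (1/2) *\<^sub>R (\<xi> k + \<eta> k))"
    using assms by (intro dyn_scale dyn_add) (auto simp: feas_at_def feas_def)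
  moreover have "normal i k \<bullet> ((1/2) *\<^sub>R (\<xi> k + \<eta> k)) \<le> 1 - f i" if "k < Suc (N + NZ)" "i \<in> {1..p}" for i k
  proof -
    have "normal i k \<bullet> \<xi> k \<le> 1 - f i" "normal i k \<bullet> \<eta> k \<le> 1 - f i"
      using assms that by (auto simp: feas_at_def feas_def)
    then show ?thesis by (simp add: inner_add_right)
  qed
  moreover have "x - fst ((1/2) *\<^sub>R (\<xi> 0 + \<eta> 0)) \<in> S"
  proof -
    have "(1/2) *\<^sub>R (x - fst (\<xi> 0)) + (1/2) *\<^sub>R (x - fst (\<eta> 0)) \<in> S"
      using assms by (intro convexD[OF convex_S]) (auto simp: feas_at_def)
    moreover have "(1/2) *\<^sub>R (x - fst (\<xi> 0)) + (1/2) *\<^sub>R (x - fst (\<eta> 0)) = x - fst ((1/2) *\<^sub>R (\<xi> 0 + \<eta> 0))"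
      by (simp add: algebra_simps scaleR_2[symmetric] flip: scaleR_add_left)
    ultimately show ?thesis by metis
  qed
  ultimately show ?thesis by (simp add: feas_at_def feas_def)
qed

lemma optimal_exists:
  assumes "x \<in> C"
  shows "\<exists>\<xi>. optimal x \<xi>"
proof -
  have "feas_at x \<noteq> {}" using assms mem_C_iff by blast
  then show ?thesis
  proof (rule minimizer_exists)
    show "l \<in> feas_at x" if "\<And>n. X n \<in> feas_at x" "\<And>k. k < Suc (N + NZ) \<Longrightarrow> (\<lambda>n. X n k) \<longlonglongrightarrow> l k" for X l
      using that by (rule feas_at_closed)
    show ?thesis if "\<xi> \<in> feas_at x" "\<And>\<eta>. \<eta> \<in> feas_at x \<Longrightarrow> form \<xi> \<xi> \<le> form \<eta> \<eta>" for \<xi>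
      using that by (intro exI[of _ \<xi>]) (simp add: optimal_def)
  qed
qed

lemma optimal_unique: "optimal x \<xi> \<Longrightarrow> optimal x \<eta> \<Longrightarrow> k < Suc (N + NZ) \<Longrightarrow> \<xi> k = \<eta> k"
  using minimizer_unique[of \<xi> "feas_at x" \<eta>] feas_at_midpoint[of \<xi> x \<eta>] by (auto simp: optimal_def)

text \<open>Both description operators are evaluated at index 0, where all minimizers agree;
  \<open>N \<ge> 1\<close> ensures that \<open>trunc\<close> keeps \<open>v 0\<close>.\<close>

lemma law_eq:
  assumes "optimal x \<xi>"
  shows "law x = snd (\<xi> 0) + KS *v (x - fst (\<xi> 0))"
proof -
  obtain \<omega> where min: "minimizer x (fst \<circ> \<xi>) (snd \<circ> \<xi>) \<omega>" using optimal_minimizer[OF assms] by blast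
  have first: "fst (\<xi> 0) = z 0" "snd (\<xi> 0) = v 0" if "minimizer x z v \<omega>'" for z v \<omega>'
    using optimal_unique[OF minimizer_optimal[OF that] assms, of 0, symmetric] N_pos
    by (simp_all add: trunc_def)
  have "optimal_z A B p c d f q e KS \<alpha> KZ N NS NZ Q R P 0 x = fst (\<xi> 0)"
    unfolding optimal_z_def
  proof (rule the_equality)
    show "\<exists>z v \<omega>. minimizer x z v \<omega> \<and> fst (\<xi> 0) = z 0"
      using min by (intro exI[of _ "fst \<circ> \<xi>"] exI[of _ "snd \<circ> \<xi>"] exI[of _ \<omega>]) simp
  qed (use first in auto)
  moreover have "optimal_v A B p c d f q e KS \<alpha> KZ N NS NZ Q R P 0 x = snd (\<xi> 0)"
    unfolding optimal_v_def
  proof (rule the_equality)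
    show "\<exists>z v \<omega>. minimizer x z v \<omega> \<and> snd (\<xi> 0) = v 0"
      using min by (intro exI[of _ "fst \<circ> \<xi>"] exI[of _ "snd \<circ> \<xi>"] exI[of _ \<omega>]) simp
  qed (use first in auto)
  ultimately show ?thesis by (simp add: tube_mpc_law_def)
qed

section \<open>Cost and feasibility of the local feedback\<close>

definition local_feedback :: "real^'n \<Rightarrow> nat \<Rightarrow> (real^'n) \<times> (real^'m)" where
  "local_feedback z k =
     (matrix_pow AZ k *v z, if k < N then KZ *v (matrix_pow AZ k *v z) else 0)"

lemma AZ_mult: "AZ *v x = A *v x + B *v (KZ *v x)"
  by (simp add: AZ_def matrix_vector_mult_add_rdistrib matrix_vector_mul_assoc)

lemma matrix_pow_Suc_mult: "matrix_pow H (Suc k) *v x = H *v (matrix_pow H k *v x)"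
  by (simp add: matrix_vector_mul_assoc)

lemma stage_local_feedback:
  assumes "k < N + NZ"
  shows "stage k (local_feedback z k) (local_feedback z k)
    = (matrix_pow AZ k *v z) \<bullet> (QZ *v (matrix_pow AZ k *v z))"
  using assms by (simp add: stage_def local_feedback_def state_weight_def input_weight_def inner_QZ)

text \<open>Along this trajectory every stage before the last costs \<open>QZ\<close>, also for
  \<open>k < N\<close>, where the weights \<open>Q\<close> and \<open>R\<close> combine. The sum
  then telescopes by \<open>lyapunov_decrease\<close>.\<close>

lemma form_local_feedback_le: "form (local_feedback z) (local_feedback z) \<le> z \<bullet> (P *v z)"
proof -
  define y where "y k = matrix_pow AZ k *v z" for k
  have "(\<Sum>k<n. y k \<bullet> (QZ *v y k)) + y n \<bullet> (P *v y n) \<le> z \<bullet> (P *v z)" for n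
  proof (induction n)
    case (Suc n)
    have "y (Suc n) \<bullet> (P *v y (Suc n)) + y n \<bullet> (QZ *v y n) \<le> y n \<bullet> (P *v y n)"
      using lyapunov_decrease[of "y n"] unfolding y_def matrix_pow_Suc_mult .
    with Suc show ?case by simp
  qed (simp add: y_def)
  from this[of "N + NZ"] show ?thesis
    using stage_local_feedback
    by (simp add: form_def y_def) (simp add: stage_def local_feedback_def state_weight_def)
qed

lemma dyn_local_feedback: "dyn (local_feedback z)"
  unfolding dyn_def local_feedback_def fst_conv snd_conv matrix_pow_Suc_mult by (simp add: AZ_mult)

text \<open>At \<open>z = 0\<close> all the finitely many inequalities hold strictly, because
  \<open>f i < 1\<close>; they persist nearby by continuity.\<close>

lemma local_feedback_feas: "\<exists>\<epsilon>>0. \<forall>z. norm z \<le> \<epsilon> \<longrightarrow> feas (local_feedback z)"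
proof -
  have "\<forall>\<^sub>F z in nhds 0. normal i k \<bullet> local_feedback z k < 1 - f i" if "i \<in> {1..p}" for i k
  proof (rule order_tendstoD(2))
    have lin: "bounded_linear (\<lambda>z. local_feedback z k)"
      by (cases "k < N")
         (simp_all add: local_feedback_def[abs_def] matrix_vector_mul_assoc bounded_linear_Pair
            matrix_vector_mul_bounded_linear bounded_linear_zero)
    have "((\<lambda>z. normal i k \<bullet> local_feedback z k) \<longlongrightarrow> normal i k \<bullet> local_feedback 0 k) (nhds 0)"
      by (intro tendsto_inner tendsto_const bounded_linear.tendsto[OF lin] tendsto_ident_at filterlim_ident)
    then show "((\<lambda>z. normal i k \<bullet> local_feedback z k) \<longlongrightarrow> 0) (nhds 0)"
      using bounded_linear.linear[OF lin] linear_0 by fastforce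
    show "0 < 1 - f i" using f_less_1[OF that] by simp
  qed
  then have "\<forall>\<^sub>F z in nhds 0. \<forall>k\<in>{..<Suc (N + NZ)}. \<forall>i\<in>{1..p}. normal i k \<bullet> local_feedback z k < 1 - f i"
    by (intro eventually_ball_finite ballI) auto
  then obtain \<delta> where "0 < \<delta>"
    "\<And>z k i. dist z 0 < \<delta> \<Longrightarrow> k < Suc (N + NZ) \<Longrightarrow> i \<in> {1..p} \<Longrightarrow> normal i k \<bullet> local_feedback z k < 1 - f i"
    unfolding eventually_nhds_metric by blast
  then have "feas (local_feedback z)" if "norm z \<le> \<delta> / 2" for z
    using that dyn_local_feedback unfolding feas_def by (fastforce simp: less_imp_le)
  with \<open>0 < \<delta>\<close> show ?thesis by (intro exI[of _ "\<delta> / 2"]) auto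
qed

section \<open>The shifted trajectory: feasibility and decrease of the cost\<close>

lemma dyn_terminal:
  assumes "dyn \<xi>" "j \<le> NZ"
  shows "fst (\<xi> (N + j)) = matrix_pow AZ j *v fst (\<xi> N)"
  using assms(2)
proof (induction j)
  case (Suc j)
  then have "fst (\<xi> (Suc (N + j))) = AZ *v fst (\<xi> (N + j))"
    using assms(1) by (simp add: dyn_def)
  with Suc show ?case by (simp add: matrix_vector_mul_assoc)
qed simp

text \<open>For \<open>N \<le> k < N + NZ\<close> the product with \<open>AZ\<close> is the next
  state anyway. At \<open>k = N + NZ\<close> it appends a new one: \<open>\<xi> (Suc k)\<close> lies
  beyond the horizon and is arbitrary. The input at \<open>N - 1\<close> comes from
  \<open>KZ\<close>, as state \<open>N\<close> moves into the first phase.\<close>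

definition shift :: "(nat \<Rightarrow> (real^'n) \<times> (real^'m)) \<Rightarrow> nat \<Rightarrow> (real^'n) \<times> (real^'m)" where
  "shift \<xi> k = (if k < N then fst (\<xi> (Suc k)) else AZ *v fst (\<xi> k),
     if Suc k < N then snd (\<xi> (Suc k)) else if Suc k = N then KZ *v fst (\<xi> N) else 0)"

lemma fst_shift:
  assumes "dyn \<xi>" "k < N + NZ"
  shows "fst (shift \<xi> k) = fst (\<xi> (Suc k))"
  using assms by (auto simp: shift_def dyn_def)

lemma dyn_shift:
  assumes "dyn \<xi>"
  shows "dyn (shift \<xi>)"
proof -
  have "fst (shift \<xi> (Suc k)) = A *v fst (shift \<xi> k) + B *v snd (shift \<xi> k)" if "k < N" for k
  proof (cases "Suc k = N")
    case True
    then show ?thesis by (simp add: shift_def AZ_mult)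
  next
    case False
    then show ?thesis using that assms by (simp add: shift_def dyn_def)
  qed
  moreover have "fst (shift \<xi> (Suc k)) = AZ *v fst (shift \<xi> k)" if "N \<le> k" "k < N + NZ" for k
    using that assms by (simp add: shift_def dyn_def)
  ultimately show ?thesis by (simp add: dyn_def)
qed

text \<open>Two indices need an argument. At \<open>Suc k = N\<close> the terminal inequality at
  state \<open>N\<close> is read as a stage inequality with input from \<open>KZ\<close>; at
  \<open>k = N + NZ\<close> the appended state is covered by \<open>terminal_invariant\<close>.
  Elsewhere inequalities of \<open>\<xi>\<close> are reused one index later.\<close>

lemma feas_shift:
  assumes "feas \<xi>"
  shows "feas (shift \<xi>)"
proof -
  have dyn: "dyn \<xi>" and ineq: "\<And>k i. k < Suc (N + NZ) \<Longrightarrow> i \<in> {1..p} \<Longrightarrow> normal i k \<bullet> \<xi> k \<le> 1 - f i"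
    using assms by (auto simp: feas_def)
  have terminal: "(c i + transpose KZ *v d i) \<bullet> fst (\<xi> (N + j)) \<le> 1 - f i" if "j \<le> NZ" "i \<in> {1..p}" for i j
    using ineq[of "N + j" i] that by (simp add: inner_normal)
  have "normal i k \<bullet> shift \<xi> k \<le> 1 - f i" if k: "k < Suc (N + NZ)" "i \<in> {1..p}" for k i
  proof -
    consider "Suc k < N" | "Suc k = N" | "N \<le> k" "k < N + NZ" | "k = N + NZ"
      using k(1) by linarith
    then show ?thesis
    proof cases
      case 1
      then show ?thesis using ineq[of "Suc k" i] k by (simp add: inner_normal shift_def)
    next
      case 2
      then have "normal i k \<bullet> shift \<xi> k = c i \<bullet> fst (\<xi> N) + d i \<bullet> (KZ *v fst (\<xi> N))"
        by (auto simp: inner_normal shift_def)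
      also have "\<dots> = (c i + transpose KZ *v d i) \<bullet> fst (\<xi> N)"
        unfolding inner_add_left inner_transpose_mult ..
      finally show ?thesis using terminal[of 0 i] k by simp
    next
      case 3
      then have "fst (\<xi> (Suc k)) = AZ *v fst (\<xi> k)" using dyn by (simp add: dyn_def)
      then show ?thesis using ineq[of "Suc k" i] k 3 by (simp add: inner_normal shift_def)
    next
      case 4
      have "(c i + transpose KZ *v d i) \<bullet> (matrix_pow AZ (NZ + 1) *v fst (\<xi> N)) \<le> 1 - f i"
        unfolding AZ_def
        by (rule terminal_invariant) (use terminal dyn_terminal[OF dyn] k in \<open>simp_all add: AZ_def\<close>)
      then show ?thesis
        using 4 dyn_terminal[OF dyn, of NZ] by (simp add: inner_normal shift_def matrix_vector_mul_assoc)
    qed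
  qed
  then show ?thesis using dyn_shift[OF dyn] by (simp add: feas_def)
qed

lemma stage_nonneg: "0 \<le> stage k a a"
  using \<mu>(2)[of a k] \<mu>(1) by (meson mult_nonneg_nonneg order_less_imp_le order_trans zero_le_power2)

text \<open>Stage \<open>k\<close> of the shift is compared with stage \<open>Suc k\<close> of
  \<open>\<xi>\<close>. Stage 0 of \<open>\<xi>\<close> has no counterpart and supplies the
  decrease; the surplus stage at the end is paid for by the Lyapunov inequality.\<close>

lemma form_shift_le:
  assumes "dyn \<xi>"
  shows "form (shift \<xi>) (shift \<xi>) \<le> form \<xi> \<xi> - \<mu> * (norm (fst (\<xi> 0)))\<^sup>2"
proof -
  obtain m where m: "N + NZ = Suc m" using N_pos by (cases "N + NZ") auto
  let ?s = "\<lambda>k. stage k (\<xi> k) (\<xi> k)" and ?t = "\<lambda>k. stage k (shift \<xi> k) (shift \<xi> k)"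
  have "form \<xi> \<xi> = ?s 0 + (\<Sum>k<m. ?s (Suc k)) + ?s (Suc m)"
    unfolding form_def unfolding m by (subst sum.lessThan_Suc_shift) simp
  moreover have "form (shift \<xi>) (shift \<xi>) = (\<Sum>k<m. ?t k) + (?t m + ?t (Suc m))"
    unfolding form_def unfolding m by simp
  moreover have snd_weight: "0 \<le> snd (\<xi> k) \<bullet> (input_weight k *v snd (\<xi> k))" for k
    using stage_nonneg[of k "(0, snd (\<xi> k))"] by (simp add: stage_def)
  have stage_shift: "?t k = fst (\<xi> (Suc k)) \<bullet> (state_weight k *v fst (\<xi> (Suc k)))
      + snd (shift \<xi> k) \<bullet> (input_weight k *v snd (shift \<xi> k))" if "k < N + NZ" for k
    using that by (simp add: stage_def fst_shift[OF assms])
  \<comment> \<open>At \<open>Suc k = N\<close> the weights are still \<open>Q\<close> and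
    \<open>R\<close>, but the input produced by \<open>KZ\<close> makes them add up to
    \<open>QZ\<close>.\<close>
  have QZ_stage: "?t k = fst (\<xi> (Suc k)) \<bullet> (QZ *v fst (\<xi> (Suc k)))" if "N \<le> Suc k" "k < N + NZ" for k
  proof (cases "Suc k = N")
    case True
    then have "state_weight k = Q" "input_weight k = R" "snd (shift \<xi> k) = KZ *v fst (\<xi> (Suc k))"
      by (auto simp: state_weight_def input_weight_def shift_def)
    then show ?thesis using stage_shift[OF that(2)] by (simp add: inner_QZ)
  next
    case False
    then show ?thesis using stage_shift[OF that(2)] that
      by (simp add: state_weight_def input_weight_def shift_def)
  qed
  have "?t k \<le> ?s (Suc k)" if "k < m" for k
  proof (cases "Suc k < N")
    case True
    then have "?t k = ?s (Suc k)" using stage_shift[of k] that m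
      by (simp add: stage_def state_weight_def input_weight_def shift_def)
    then show ?thesis by simp
  next
    case False
    then have "?t k = fst (\<xi> (Suc k)) \<bullet> (state_weight (Suc k) *v fst (\<xi> (Suc k)))"
      using QZ_stage[of k] that m by (simp add: state_weight_def)
    then show ?thesis using snd_weight[of "Suc k"] by (simp add: stage_def)
  qed
  then have "(\<Sum>k<m. ?t k) \<le> (\<Sum>k<m. ?s (Suc k))" by (intro sum_mono) auto
  \<comment> \<open>The terminal cost of \<open>\<xi>\<close> at \<open>Suc m = N + NZ\<close>
    splits into one \<open>QZ\<close> stage and the terminal cost at the appended state.\<close>
  moreover have "?t m + ?t (Suc m) \<le> ?s (Suc m)"
  proof -
    have "fst (shift \<xi> (Suc m)) = AZ *v fst (\<xi> (Suc m))" "snd (shift \<xi> (Suc m)) = 0"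
      "state_weight (Suc m) = P"
      using m by (auto simp: shift_def state_weight_def)
    then show ?thesis
      using QZ_stage[of m] m lyapunov_decrease[of "fst (\<xi> (Suc m))"] snd_weight[of "Suc m"]
      by (simp add: stage_def)
  qed
  moreover have "\<mu> * (norm (fst (\<xi> 0)))\<^sup>2 \<le> ?s 0"
  proof -
    have "(norm (fst (\<xi> 0)))\<^sup>2 \<le> (norm (\<xi> 0))\<^sup>2" using norm_fst_le[of "fst (\<xi> 0)" "snd (\<xi> 0)"] by (simp add: power_mono)
    then show ?thesis using \<mu> by (meson mult_left_mono order_less_imp_le order_trans)
  qed
  ultimately show ?thesis by linarith
qed

text \<open>The nominal terms cancel, so the error \<open>x - fst (\<xi> 0)\<close> evolves by
  \<open>A + B ** KS\<close> plus the disturbance and remains in \<open>S\<close> by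
  \<open>S_invariant\<close>.\<close>

lemma optimal_step:
  assumes "optimal x \<xi>" "w \<in> W"
  shows "shift \<xi> \<in> feas_at (A *v x + B *v law x + w)"
proof -
  have \<xi>: "feas \<xi>" "x - fst (\<xi> 0) \<in> S" using assms by (auto simp: optimal_def feas_at_def)
  have "fst (shift \<xi> 0) = A *v fst (\<xi> 0) + B *v snd (\<xi> 0)"
    using \<xi>(1) N_pos by (simp add: shift_def feas_def dyn_def)
  then have "A *v x + B *v law x + w - fst (shift \<xi> 0) = (A + B ** KS) *v (x - fst (\<xi> 0)) + w"
    unfolding law_eq[OF assms(1)]
    by (simp add: matrix_vector_mult_add_rdistrib matrix_vector_right_distrib
        matrix_vector_mult_diff_distrib matrix_vector_mul_assoc algebra_simps)
  then have "A *v x + B *v law x + w - fst (shift \<xi> 0) \<in> S"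
    using S_invariant[OF \<xi>(2) assms(2)] by (simp only:)
  then show ?thesis using feas_shift[OF \<xi>(1)] by (simp add: feas_at_def)
qed

section \<open>Bounds on the optimal cost\<close>

lemma feas_0: "feas (\<lambda>k. 0)"
  using f_less_1 by (auto simp: feas_def dyn_def intro: less_imp_le)

lemma S_subset_C: "S \<subseteq> C"
proof
  fix x assume "x \<in> S"
  then have "(\<lambda>k. 0) \<in> feas_at x" using feas_0 by (simp add: feas_at_def)
  then show "x \<in> C" using mem_C_iff by blast
qed

text \<open>An optimal trajectory is also optimal among those with its own initial nominal state,
  since these satisfy the same condition on \<open>S\<close>. That problem no longer involves
  \<open>x\<close> or \<open>S\<close>, and the growth lemma applies with \<open>fst\<close> as
  projection.\<close>

lemma optimal_growth: "\<exists>L. \<forall>x \<xi>. optimal x \<xi> \<longrightarrow> form \<xi> \<xi> \<le> L * (1 + norm (fst (\<xi> 0)))\<^sup>2"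
proof -
  have "\<exists>L. \<forall>\<xi>. feas \<xi> \<and> (\<forall>\<eta>. feas \<eta> \<and> fst (\<eta> 0) = fst (\<xi> 0) \<longrightarrow> form \<xi> \<xi> \<le> form \<eta> \<eta>)
           \<longrightarrow> form \<xi> \<xi> \<le> L * (1 + norm (fst (\<xi> 0)))\<^sup>2"
    unfolding feas_def
  proof (rule minimizer_linear_growth)
    show "0 \<le> 1 - f i" if "i \<in> {1..p}" for i using f_less_1[OF that] by simp
    show "l \<in> Collect dyn" if "\<And>n. X n \<in> Collect dyn" "\<And>k. k < Suc (N + NZ) \<Longrightarrow> (\<lambda>n. X n k) \<longlonglongrightarrow> l k" for X l
      using dyn_closed[of X l] that by simp
  qed (auto intro: dyn_scale dyn_diff bounded_linear_fst)
  then obtain L where L: "\<And>\<xi>. feas \<xi> \<Longrightarrow> (\<And>\<eta>. feas \<eta> \<Longrightarrow> fst (\<eta> 0) = fst (\<xi> 0) \<Longrightarrow> form \<xi> \<xi> \<le> form \<eta> \<eta>)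
           \<Longrightarrow> form \<xi> \<xi> \<le> L * (1 + norm (fst (\<xi> 0)))\<^sup>2" by blast
  have "form \<xi> \<xi> \<le> L * (1 + norm (fst (\<xi> 0)))\<^sup>2" if "optimal x \<xi>" for x \<xi>
    using that by (intro L) (auto simp: optimal_def feas_at_def)
  then show ?thesis by blast
qed

text \<open>
  For \<open>x\<close> close to \<open>s\<close> the local feedback \<open>KZ\<close> started at \<open>x - s\<close> is feasible; otherwise the affine
  growth bound suffices. Taking \<open>s\<close> nearest to \<open>x\<close> bounds the optimal cost by the distance to \<open>S\<close>,
  and taking \<open>s = x - z\<^sub>0\<close> bounds it by the optimal initial nominal state \<open>z\<^sub>0\<close>.
\<close>

lemma optimal_le_of_decomposition:
  "\<exists>\<gamma>>0. \<forall>x \<xi> s. optimal x \<xi> \<and> s \<in> S \<longrightarrow> form \<xi> \<xi> \<le> \<gamma> * (norm (x - s))\<^sup>2"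
proof -
  obtain \<epsilon> where \<epsilon>: "0 < \<epsilon>" "\<And>z. norm z \<le> \<epsilon> \<Longrightarrow> feas (local_feedback z)"
    using local_feedback_feas by blast
  obtain L where "\<And>x \<xi>. optimal x \<xi> \<Longrightarrow> form \<xi> \<xi> \<le> L * (1 + norm (fst (\<xi> 0)))\<^sup>2"
    using optimal_growth by blast
  then have L: "form \<xi> \<xi> \<le> \<bar>L\<bar> * (1 + norm (fst (\<xi> 0)))\<^sup>2" if "optimal x \<xi>" for x \<xi>
    using that by (meson abs_ge_self mult_right_mono order_trans zero_le_power2)
  obtain K where K: "0 < K" "\<And>x. x \<bullet> (P *v x) \<le> K * (norm x)\<^sup>2"
    using quadratic_form_bounded by blast
  obtain b where b: "0 < b" "\<And>s. s \<in> S \<Longrightarrow> norm s \<le> b"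
    using compact_imp_bounded[OF compact_S] bounded_pos by blast
  \<comment> \<open>Chosen so that \<open>1 + (\<delta> + 2 * b) \<le> \<beta> * \<delta>\<close>
    whenever \<open>\<epsilon> \<le> \<delta>\<close>: away from \<open>S\<close> the affine bound
    becomes a linear one. The two copies of \<open>b\<close> bound \<open>s\<close> and
    \<open>x - fst (\<xi> 0)\<close>.\<close>
  define \<beta> where "\<beta> = 1 + (1 + 2 * b) / \<epsilon>"
  define \<gamma> where "\<gamma> = K + \<bar>L\<bar> * \<beta>\<^sup>2"
  have \<gamma>: "0 < \<gamma>" "K \<le> \<gamma>" "\<bar>L\<bar> * \<beta>\<^sup>2 \<le> \<gamma>" using K(1) by (auto simp: \<gamma>_def add_pos_nonneg)
  have "form \<xi> \<xi> \<le> \<gamma> * (norm (x - s))\<^sup>2" if opt: "optimal x \<xi>" and s: "s \<in> S" for x \<xi> s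
  proof (cases "norm (x - s) \<le> \<epsilon>")
    case True
    have "local_feedback (x - s) \<in> feas_at x"
      using \<epsilon>(2)[OF True] s by (simp add: feas_at_def local_feedback_def)
    then have "form \<xi> \<xi> \<le> (x - s) \<bullet> (P *v (x - s))"
      using opt form_local_feedback_le[of "x - s"] unfolding optimal_def by (meson order_trans)
    also have "\<dots> \<le> K * (norm (x - s))\<^sup>2" by (rule K(2))
    also have "\<dots> \<le> \<gamma> * (norm (x - s))\<^sup>2" using \<gamma>(2) by (intro mult_right_mono) auto
    finally show ?thesis .
  next
    case False
    define \<delta> where "\<delta> = norm (x - s)"
    have \<delta>: "\<epsilon> \<le> \<delta>" using False by (simp add: \<delta>_def)
    have "x - fst (\<xi> 0) \<in> S" using opt by (simp add: optimal_def feas_at_def)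
    then have "norm (x - fst (\<xi> 0)) \<le> b" by (rule b(2))
    moreover have "norm (fst (\<xi> 0)) \<le> norm (x - s) + norm s + norm (x - fst (\<xi> 0))"
      using norm_triangle_ineq[of "x - s" s] norm_triangle_ineq4[of x "x - fst (\<xi> 0)"] by simp
    ultimately have "1 + norm (fst (\<xi> 0)) \<le> 1 + (\<delta> + 2 * b)" using b(2)[OF s] by (simp add: \<delta>_def)
    also have "\<dots> \<le> \<beta> * \<delta>"
    proof -
      have "1 \<le> \<delta> / \<epsilon>" using \<delta> \<epsilon>(1) by simp
      then have "(1 + 2 * b) * 1 \<le> (1 + 2 * b) * (\<delta> / \<epsilon>)" using b(1) by (intro mult_left_mono) auto
      moreover have "\<beta> * \<delta> = \<delta> + (1 + 2 * b) * (\<delta> / \<epsilon>)" by (simp add: \<beta>_def distrib_right)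
      ultimately show ?thesis by simp
    qed
    finally have "(1 + norm (fst (\<xi> 0)))\<^sup>2 \<le> (\<beta> * \<delta>)\<^sup>2" by (intro power_mono) auto
    then have "\<bar>L\<bar> * (1 + norm (fst (\<xi> 0)))\<^sup>2 \<le> \<bar>L\<bar> * (\<beta> * \<delta>)\<^sup>2" by (intro mult_left_mono) auto
    also have "\<dots> = (\<bar>L\<bar> * \<beta>\<^sup>2) * \<delta>\<^sup>2" by (simp add: power_mult_distrib)
    also have "\<dots> \<le> \<gamma> * \<delta>\<^sup>2" using \<gamma>(3) by (intro mult_right_mono) auto
    finally show ?thesis using L[OF opt] by (simp add: \<delta>_def)
  qed
  then show ?thesis using \<gamma>(1) by blast
qed

text \<open>The optimal cost contracts by \<open>\<rho>\<close> at each step. It is compared with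
  squared distances, hence the rate \<open>sqrt \<rho>\<close> and the constant
  \<open>sqrt (\<gamma> / \<mu>)\<close>.\<close>

theorem robustly_exponentially_stable_law:
  "robustly_exponentially_stable S (\<lambda>x. A *v x + B *v law x) W C"
proof -
  obtain \<gamma>' where "0 < \<gamma>'" and \<gamma>': "\<And>x \<xi> s. optimal x \<xi> \<Longrightarrow> s \<in> S \<Longrightarrow> form \<xi> \<xi> \<le> \<gamma>' * (norm (x - s))\<^sup>2"
    using optimal_le_of_decomposition by blast
  \<comment> \<open>Enlarging the constant by \<open>2 * \<mu>\<close> gives
    \<open>\<mu> / \<gamma> < 1\<close>, so that \<open>\<rho>\<close> is positive as the definition
    of stability demands.\<close>
  define \<gamma> where "\<gamma> = \<gamma>' + 2 * \<mu>"
  have \<gamma>_pos: "0 < \<gamma>" using \<open>0 < \<gamma>'\<close> \<mu>(1) by (simp add: \<gamma>_def)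
  have \<gamma>: "form \<xi> \<xi> \<le> \<gamma> * (norm (x - s))\<^sup>2" if "optimal x \<xi>" "s \<in> S" for x \<xi> s
  proof -
    have "\<gamma>' * (norm (x - s))\<^sup>2 \<le> \<gamma> * (norm (x - s))\<^sup>2"
      using \<mu>(1) by (intro mult_right_mono) (auto simp: \<gamma>_def)
    then show ?thesis using \<gamma>'[OF that] by linarith
  qed
  define \<rho> where "\<rho> = 1 - \<mu> / \<gamma>"
  have \<rho>: "0 < \<rho>" "\<rho> < 1" using \<mu>(1) \<open>0 < \<gamma>'\<close> \<gamma>_pos by (auto simp: \<rho>_def \<gamma>_def field_simps)
  have "x k \<in> C \<and> infdist (x k) S \<le> sqrt (\<gamma> / \<mu>) * sqrt \<rho> ^ k * infdist (x 0) S"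
    if x: "x 0 \<in> C" "\<And>k. x (Suc k) \<in> {A *v x k + B *v law (x k)} + W" for x k
  proof -
    have step: "\<exists>w\<in>W. x (Suc k) = A *v x k + B *v law (x k) + w" for k
      using x(2)[of k] by (auto simp: set_plus_def)
    have C: "x k \<in> C" for k
    proof (induction k)
      case (Suc k)
      then obtain \<xi> where "optimal (x k) \<xi>" using optimal_exists by blast
      then show ?case using step[of k] optimal_step mem_C_iff by (metis empty_iff)
    qed (rule x(1))
    then have "\<forall>k. \<exists>\<xi>. optimal (x k) \<xi>" using optimal_exists by blast
    then obtain \<xi> where \<xi>: "\<And>k. optimal (x k) (\<xi> k)" by metis
    have mem: "x k - fst (\<xi> k 0) \<in> S" for k using \<xi>[of k] by (simp add: optimal_def feas_at_def)
    let ?V = "\<lambda>k. form (\<xi> k) (\<xi> k)"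
    have V_decrease: "?V (Suc k) \<le> \<rho> * ?V k" for k
    proof -
      obtain w where w: "w \<in> W" "x (Suc k) = A *v x k + B *v law (x k) + w" using step by blast
      have "shift (\<xi> k) \<in> feas_at (x (Suc k))" unfolding w(2) using \<xi> w(1) by (rule optimal_step)
      then have "?V (Suc k) \<le> form (shift (\<xi> k)) (shift (\<xi> k))"
        using \<xi>[of "Suc k"] unfolding optimal_def by blast
      also have "\<dots> \<le> ?V k - \<mu> * (norm (fst (\<xi> k 0)))\<^sup>2"
        using \<xi>[of k] by (intro form_shift_le) (simp add: optimal_def feas_at_def feas_def)
      also have "\<dots> \<le> ?V k - \<mu> * (?V k / \<gamma>)"
      proof -
        \<comment> \<open>The point of \<open>S\<close> is \<open>x k - fst (\<xi> k 0)\<close>,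
          which turns the decrease in the nominal state into one proportional to the cost.\<close>
        have "?V k \<le> \<gamma> * (norm (x k - (x k - fst (\<xi> k 0))))\<^sup>2"
          using \<xi> mem by (rule \<gamma>)
        then have "?V k / \<gamma> \<le> (norm (fst (\<xi> k 0)))\<^sup>2"
          using \<gamma>_pos by (simp add: pos_divide_le_eq mult.commute)
        then show ?thesis using \<mu>(1) by (intro diff_left_mono mult_left_mono) auto
      qed
      also have "\<dots> = \<rho> * ?V k" by (simp add: \<rho>_def algebra_simps)
      finally show ?thesis .
    qed
    have V_le: "?V k \<le> \<rho> ^ k * ?V 0" for k
    proof (induction k)
      case (Suc k)
      have "\<rho> * ?V k \<le> \<rho> * (\<rho> ^ k * ?V 0)" using Suc \<rho>(1) by (intro mult_left_mono) auto
      then show ?case using V_decrease[of k] by simp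
    qed simp
    have "S \<noteq> {}" using zero_S by blast
    obtain s where s: "s \<in> S" "infdist (x 0) S = dist (x 0) s"
      using infdist_attains_inf[OF compact_imp_closed[OF compact_S] \<open>S \<noteq> {}\<close>] by blast
    \<comment> \<open>The chain passes from the distance at time \<open>k\<close> to the cost, back
      to the cost at time 0, and from there to the distance through the nearest point
      \<open>s\<close>.\<close>
    have "(infdist (x k) S)\<^sup>2 \<le> (norm (fst (\<xi> k 0)))\<^sup>2"
      using infdist_le[OF mem, of "x k" k] by (intro power_mono infdist_nonneg) (simp add: dist_norm)
    also have "\<dots> \<le> (norm (\<xi> k 0))\<^sup>2" using norm_fst_le[of "fst (\<xi> k 0)" "snd (\<xi> k 0)"] by (simp add: power_mono)
    also have "\<dots> \<le> ?V k / \<mu>"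
      using coercive_form[of 0 "\<xi> k"] \<mu>(1) by (simp add: pos_le_divide_eq mult.commute)
    also have "\<dots> \<le> \<rho> ^ k * ?V 0 / \<mu>" using V_le[of k] \<mu>(1) by (intro divide_right_mono) auto
    also have "\<dots> \<le> \<rho> ^ k * (\<gamma> * (infdist (x 0) S)\<^sup>2) / \<mu>"
      using \<gamma>[OF \<xi>[of 0] s(1)] \<rho>(1) \<mu>(1) s(2)
      by (intro divide_right_mono mult_left_mono) (auto simp: dist_norm)
    also have "\<dots> = (sqrt (\<gamma> / \<mu>) * sqrt \<rho> ^ k * infdist (x 0) S)\<^sup>2"
    proof -
      have "(sqrt \<rho> ^ k)\<^sup>2 = \<rho> ^ k"
        using \<rho>(1) by (metis less_imp_le power_mult mult.commute real_sqrt_pow2)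
      then show ?thesis using \<gamma>_pos \<mu>(1) by (simp add: power_mult_distrib)
    qed
    finally have "infdist (x k) S \<le> sqrt (\<gamma> / \<mu>) * sqrt \<rho> ^ k * infdist (x 0) S"
      by (rule power2_le_imp_le) (use \<rho>(1) \<gamma>_pos \<mu>(1) in \<open>simp add: infdist_nonneg\<close>)
    then show ?thesis using C by blast
  qed
  moreover have "0 < sqrt (\<gamma> / \<mu>)" "0 < sqrt \<rho>" "sqrt \<rho> < 1"
    using \<rho> \<gamma>_pos \<mu>(1) by auto
  ultimately show ?thesis
    unfolding robustly_exponentially_stable_def
    using S_subset_C compact_imp_closed[OF compact_S] by blast
qed

end

section \<open>The rigid tube and the terminal set\<close>

lemma mem_rigid_tube_set_iff:
  "s \<in> rigid_tube_set M \<alpha> n W \<longleftrightarrow>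
     (\<exists>\<omega>. (\<forall>j<n. \<omega> j \<in> W) \<and> s = inverse (1 - \<alpha>) *\<^sub>R (\<Sum>j<n. matrix_pow M j *v \<omega> j))" (is "_ \<longleftrightarrow> ?r")
proof
  assume "s \<in> rigid_tube_set M \<alpha> n W"
  then obtain y where y: "\<forall>j\<in>{..<n}. y j \<in> (\<lambda>w. matrix_pow M j *v w) ` W"
    and s: "s = inverse (1 - \<alpha>) *\<^sub>R sum y {..<n}"
    by (auto simp: rigid_tube_set_def set_sum_alt)
  from y have "\<forall>j\<in>{..<n}. \<exists>w. w \<in> W \<and> y j = matrix_pow M j *v w" by blast
  then obtain \<omega> where \<omega>: "\<forall>j\<in>{..<n}. \<omega> j \<in> W \<and> y j = matrix_pow M j *v \<omega> j"
    using bchoice by metis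
  then have "sum y {..<n} = (\<Sum>j<n. matrix_pow M j *v \<omega> j)" by (intro sum.cong) auto
  then show ?r using \<omega> s by auto
next
  assume ?r
  then show "s \<in> rigid_tube_set M \<alpha> n W" by (auto simp: rigid_tube_set_def set_sum_alt)
qed

lemma compact_sum_sets:
  fixes X :: "nat \<Rightarrow> 'a::real_normed_vector set"
  assumes "\<And>j. compact (X j)"
  shows "compact (\<Sum>j<n. X j)"
proof (induction n)
  case (Suc n)
  have "compact {x + y |x y. x \<in> (\<Sum>j<n. X j) \<and> y \<in> X n}"
    using Suc assms by (rule compact_sums)
  moreover have "{x + y |x y. x \<in> (\<Sum>j<n. X j) \<and> y \<in> X n} = (\<Sum>j<n. X j) + X n"
    by (auto simp: set_plus_def)
  ultimately show ?case by simp
qed (simp add: set_zero)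

lemma compact_rigid_tube_set:
  assumes "compact W"
  shows "compact (rigid_tube_set M \<alpha> n W)"
  unfolding rigid_tube_set_def
  by (intro compact_scaling compact_sum_sets compact_continuous_image linear_continuous_on
      matrix_vector_mul_bounded_linear assms)

lemma convex_rigid_tube_set:
  assumes "convex W"
  shows "convex (rigid_tube_set M \<alpha> n W)"
  unfolding rigid_tube_set_def
  by (intro convex_scaling convex_set_sum convex_linear_image matrix_vector_mul_linear assms)

text \<open>Multiplication by \<open>M\<close> moves each summand up by one index. The top one
  becomes \<open>\<alpha> *\<^sub>R w'\<close> with \<open>w' \<in> W\<close> by contractivity, and
  the disturbance, rescaled to undo the factor \<open>inverse (1 - \<alpha>)\<close>, is
  \<open>(1 - \<alpha>) *\<^sub>R w\<close>. Their sum is a convex combination in \<open>W\<close>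
  and fills the vacated index 0.\<close>

lemma rigid_tube_set_invariant:
  assumes "convex W" "0 \<le> \<alpha>" "\<alpha> < 1" "0 < n"
    and contractive: "(\<lambda>w. matrix_pow M n *v w) ` W \<subseteq> (\<lambda>w. \<alpha> *\<^sub>R w) ` W"
    and s: "s \<in> rigid_tube_set M \<alpha> n W" and w: "w \<in> W"
  shows "M *v s + w \<in> rigid_tube_set M \<alpha> n W"
proof -
  obtain m where n: "n = Suc m" using assms(4) by (cases n) auto
  obtain \<omega> where \<omega>: "\<And>j. j < n \<Longrightarrow> \<omega> j \<in> W"
    and s_eq: "s = inverse (1 - \<alpha>) *\<^sub>R (\<Sum>j<n. matrix_pow M j *v \<omega> j)"
    using s mem_rigid_tube_set_iff by blast
  obtain w' where w': "w' \<in> W" "matrix_pow M n *v \<omega> m = \<alpha> *\<^sub>R w'"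
    using contractive \<omega>[of m] n by blast
  define \<omega>' where "\<omega>' j = (case j of 0 \<Rightarrow> \<alpha> *\<^sub>R w' + (1 - \<alpha>) *\<^sub>R w | Suc i \<Rightarrow> \<omega> i)" for j
  have "\<omega>' j \<in> W" if "j < n" for j
    using that \<omega> convexD[OF assms(1) w'(1) w, of \<alpha> "1 - \<alpha>"] assms(2,3)
    by (cases j) (auto simp: \<omega>'_def)
  moreover have "M *v s + w = inverse (1 - \<alpha>) *\<^sub>R (\<Sum>j<n. matrix_pow M j *v \<omega>' j)"
  proof -
    have "M *v (\<Sum>j<n. matrix_pow M j *v \<omega> j) = (\<Sum>j<n. matrix_pow M (Suc j) *v \<omega> j)"
      by (simp add: linear_sum[OF matrix_vector_mul_linear] matrix_vector_mul_assoc)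
    also have "\<dots> = (\<Sum>j<m. matrix_pow M (Suc j) *v \<omega> j) + \<alpha> *\<^sub>R w'"
      using w'(2) unfolding n by simp
    finally have "M *v (\<Sum>j<n. matrix_pow M j *v \<omega> j) + (1 - \<alpha>) *\<^sub>R w
        = (\<Sum>j<n. matrix_pow M j *v \<omega>' j)"
      unfolding n by (subst sum.lessThan_Suc_shift) (simp add: \<omega>'_def)
    moreover have "w = inverse (1 - \<alpha>) *\<^sub>R ((1 - \<alpha>) *\<^sub>R w)" using assms(3) by simp
    ultimately show ?thesis
      unfolding s_eq matrix_vector_mult_scaleR by (metis scaleR_add_right)
  qed
  ultimately show ?thesis using mem_rigid_tube_set_iff by blast
qed

text \<open>A point of largest norm would be \<open>\<alpha>\<close> times a point of
  \<open>W\<close>, hence zero, while \<open>{0}\<close> has empty interior. This excludes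
  \<open>NS = 0\<close>, for which the contractivity assumption reads
  \<open>W \<subseteq> \<alpha> W\<close>.\<close>

lemma not_subset_scaled:
  fixes W :: "'a::euclidean_space set"
  assumes "compact W" "0 \<in> interior W" "0 \<le> \<alpha>" "\<alpha> < 1"
  shows "\<not> W \<subseteq> (\<lambda>w. \<alpha> *\<^sub>R w) ` W"
proof
  assume sub: "W \<subseteq> (\<lambda>w. \<alpha> *\<^sub>R w) ` W"
  have "W \<noteq> {}" using assms(2) interior_subset by blast
  then obtain u where u: "u \<in> W" "\<And>w. w \<in> W \<Longrightarrow> norm w \<le> norm u"
    using continuous_attains_sup[OF assms(1) _ continuous_on_norm_id] by blast
  obtain v where v: "v \<in> W" "u = \<alpha> *\<^sub>R v" using sub u(1) by blast
  have "norm u \<le> \<alpha> * norm u" using v u(2)[OF v(1)] assms(3) by (simp add: mult_left_mono)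
  then have "(1 - \<alpha>) * norm u \<le> 0" by (simp add: algebra_simps)
  then have "norm u = 0" using assms(4) by (simp add: mult_le_0_iff)
  then have "W \<subseteq> {0}" using u(2) by auto
  then have "interior W \<subseteq> interior {0}" by (rule interior_mono)
  then show False using assms(2) by simp
qed

text \<open>With input \<open>KZ *v z + KS *v s\<close> each inequality separates into a part in
  \<open>z\<close> and a part in \<open>s\<close>. Requiring it for all \<open>s \<in> S\<close>
  replaces the latter by its supremum, a genuine one by compactness.\<close>

lemma terminal_constraint_iff:
  fixes c :: "nat \<Rightarrow> real^'n" and d :: "nat \<Rightarrow> real^'m" and KS KZ :: "real^'n^'m"
  assumes "compact S" "S \<noteq> {}"
  shows "(z, KZ *v z) \<in> tightened_constraints {(x, u). \<forall>i\<in>I. c i \<bullet> x + d i \<bullet> u \<le> 1} KS S \<longleftrightarrow>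
    (\<forall>i\<in>I. (c i + transpose KZ *v d i) \<bullet> z \<le> 1 - support_function S (c i + transpose KS *v d i))"
proof -
  have split: "c i \<bullet> (z + s) + d i \<bullet> (KZ *v z + KS *v s)
      = (c i + transpose KZ *v d i) \<bullet> z + (c i + transpose KS *v d i) \<bullet> s" for i s
    unfolding inner_add_left inner_add_right inner_transpose_mult by simp
  have "(\<forall>s\<in>S. (c i + transpose KZ *v d i) \<bullet> z + y \<bullet> s \<le> 1) \<longleftrightarrow>
      (c i + transpose KZ *v d i) \<bullet> z \<le> 1 - support_function S y" for i y
  proof -
    have "bdd_above ((\<lambda>s. y \<bullet> s) ` S)"
      by (intro bounded_imp_bdd_above compact_imp_bounded compact_continuous_image assms(1) continuous_intros)
    then have "support_function S y \<le> t \<longleftrightarrow> (\<forall>s\<in>S. y \<bullet> s \<le> t)" for t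
      unfolding support_function_def using assms(2) by (intro cSUP_le_iff)
    from this[of "1 - (c i + transpose KZ *v d i) \<bullet> z"] show ?thesis by (auto simp: algebra_simps)
  qed
  then show ?thesis
    unfolding tightened_constraints_def mem_Collect_eq case_prod_conv split by blast
qed



theorem theorem3:
  fixes A :: "real^'n^'n" and B :: "real^'m^'n"
    and p :: nat and c :: "nat \<Rightarrow> real^'n" and d :: "nat \<Rightarrow> real^'m"
    and q :: nat and e :: "nat \<Rightarrow> real^'n"
    and Q P :: "real^'n^'n" and R :: "real^'m^'m"
    and KS KZ :: "real^'n^'m"
    and \<alpha> :: real and N NS NZ :: nat
    and Y YS :: "((real^'n) \<times> (real^'m)) set" and W S ZS Zf :: "(real^'n) set"
    and f :: "nat \<Rightarrow> real"
  assumes stabilizable: "strictly_stabilizable A B"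
    and Y_eq: "Y = {(x, u). \<forall>i\<in>{1..p}. c i \<bullet> x + d i \<bullet> u \<le> 1}"
    and Y_polyhedral: "polyhedron Y"
    and Y_proper: "proper_D_set Y"
    and Y_irreducible: "irreducible_representation {1..p} (\<lambda>i. {(x, u). c i \<bullet> x + d i \<bullet> u \<le> 1})"
    and W_eq: "W = {w. \<forall>i\<in>{1..q}. e i \<bullet> w \<le> 1}"
    and W_polyhedral: "polyhedron W"
    and W_proper: "proper_C_set W"
    and W_irreducible: "irreducible_representation {1..q} (\<lambda>i. {w. e i \<bullet> w \<le> 1})"
    and Q_pos_def: "sym_pos_def Q"
    and R_pos_def: "sym_pos_def R"
    and KS_stable: "strictly_stable (A + B ** KS)"
    and alpha_nonneg: "0 \<le> \<alpha>" and alpha_less_1: "\<alpha> < 1"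
    and NS: "(\<lambda>w. matrix_pow (A + B ** KS) NS *v w) ` W \<subseteq> (\<lambda>w. \<alpha> *\<^sub>R w) ` W"
    and S_eq: "S = rigid_tube_set (A + B ** KS) \<alpha> NS W"
    and f_eq: "\<And>i. i \<in> {1..p} \<Longrightarrow> f i = support_function S (c i + transpose KS *v d i)"
    and f_less_1: "\<And>i. i \<in> {1..p} \<Longrightarrow> f i < 1"
    and YS_eq: "YS = tightened_constraints Y KS S"
    and KZ_stable: "strictly_stable (A + B ** KZ)"
    and ZS_eq: "ZS = {z. (z, KZ *v z) \<in> YS}"
    and Zf_eq: "Zf = terminal_set (A + B ** KZ) NZ ZS"
    and NZ: "Zf \<subseteq> (\<lambda>z. matrix_pow (A + B ** KZ) (NZ + 1) *v z) -` ZS"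
    and P_pos_def: "sym_pos_def P"
    and P_lyapunov: "loewner_le (transpose (A + B ** KZ) ** P ** (A + B ** KZ) - P)
                       (- (Q + transpose KZ ** R ** KZ))"
    and N_pos: "N \<ge> 1"
  shows "robustly_exponentially_stable S
           (\<lambda>x. A *v x + B *v tube_mpc_law A B p c d f q e KS \<alpha> KZ N NS NZ Q R P x)
           W
           (controllable_set A B p c d f q e KS \<alpha> KZ N NS NZ)"
proof -
  have W: "compact W" "convex W" "0 \<in> interior W"
    using W_proper by (auto simp: proper_C_set_def proper_D_set_def compact_eq_bounded_closed)
  then have "0 \<in> W" using interior_subset by blast
  have "0 < NS"
  proof (rule ccontr)
    assume "\<not> 0 < NS"
    then show False using NS not_subset_scaled[OF W(1,3) alpha_nonneg alpha_less_1] by simp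
  qed
  have S_iff: "s \<in> S \<longleftrightarrow> (\<exists>\<omega>. (\<forall>j<NS. \<forall>i\<in>{1..q}. e i \<bullet> \<omega> j \<le> 1) \<and>
      s = inverse (1 - \<alpha>) *\<^sub>R (\<Sum>j<NS. matrix_pow (A + B ** KS) j *v \<omega> j))" for s
    unfolding S_eq mem_rigid_tube_set_iff by (simp only: W_eq mem_Collect_eq)
  have S: "compact S" "convex S"
    unfolding S_eq using W by (simp_all add: compact_rigid_tube_set convex_rigid_tube_set)
  have "0 \<in> S" unfolding S_iff by (intro exI[of _ "\<lambda>_. 0"]) simp
  then have ZS_iff: "z \<in> ZS \<longleftrightarrow> (\<forall>i\<in>{1..p}. (c i + transpose KZ *v d i) \<bullet> z \<le> 1 - f i)" for z
    unfolding ZS_eq YS_eq Y_eq mem_Collect_eq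
    by (subst terminal_constraint_iff[OF S(1)]) (use f_eq in auto)
  interpret rigid_tube A B p c d q e Q P R KS KZ \<alpha> N NS NZ W S f
  proof (rule rigid_tube.intro)
    fix z i
    assume "\<And>j i. j \<le> NZ \<Longrightarrow> i \<in> {1..p} \<Longrightarrow>
        (c i + transpose KZ *v d i) \<bullet> (matrix_pow (A + B ** KZ) j *v z) \<le> 1 - f i"
    then have "z \<in> Zf" unfolding Zf_eq terminal_set_def by (simp add: ZS_iff)
    then have "matrix_pow (A + B ** KZ) (NZ + 1) *v z \<in> ZS" using NZ by blast
    then show "i \<in> {1..p} \<Longrightarrow>
        (c i + transpose KZ *v d i) \<bullet> (matrix_pow (A + B ** KZ) (NZ + 1) *v z) \<le> 1 - f i"
      unfolding ZS_iff by blast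
  next
    show "(A + B ** KS) *v s + w \<in> S" if "s \<in> S" "w \<in> W" for s w
      using rigid_tube_set_invariant[OF W(2) alpha_nonneg alpha_less_1 \<open>0 < NS\<close> NS] that
      unfolding S_eq by blast
  qed (fact Q_pos_def R_pos_def P_pos_def P_lyapunov f_less_1 N_pos S_iff S \<open>0 \<in> S\<close>)+
  show ?thesis by (rule robustly_exponentially_stable_law)
qed

end
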